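(* Let $q$ be a prime power and $n\ge2$ with $\gcd(q,n)=1$, and use the notation of the context. Let $I\subset\mathbb{F}_qD_n$ be a dihedral code and write $$\mathcal{P}(I)=\bigoplus_{j=1}^{r+s}B_j,\qquad B_j=\begin{cases}A_j,&j\in J_1\\ I_j(0,1),&j\in J_2\\ I_j(1,0),&j\in J_3\\ I_j(-x_j,1),&j\in J_4\\ 0,&j\notin J_1\cup J_2\cup J_3\cup J_4,\end{cases}$$ where $0\ne x_j\in F_j$ and $J_1,J_2,J_3\subset\{1,\dots,r+s\}$, $J_4\subset\{\zeta(n)+1,\dots,r+s\}$ are pairwise disjoint, with $1\notin J_2$ if $q$ is even. Let $I^\perp\subset\mathbb{F}_qD_n$ be the dual code of $I$. Then $\mathcal{P}(I^\perp)=\bigoplus_{j=1}^{r+s}\hat B_j$, where 1) for $1\le j\le\zeta(n)$: $$\hat B_j=\begin{cases}A_j,&B_j=0\\ I_j(0,1),&B_j=I_j(1,0)\\ I_j(1,0),&B_j=I_j(0,1)\\ 0,&B_j=A_j;\end{cases}$$ 2) for $\zeta(n)+1\le j\le r$: $$\hat B_j=\begin{cases}A_j,&B_j=0\\ I_j(\alpha_j+\alpha_j^{-1},\,2),&B_j=I_j(1,0)\\ I_j(2,\,\alpha_j+\alpha_j^{-1}),&B_j=I_j(0,1)\\ I_j\left(2+(\alpha_j+\alpha_j^{-1})x_j,\ (\alpha_j+\alpha_j^{-1})+2x_j\right),&B_j=I_j(-x_j,1)\\ 0,&B_j=A_j;\end{cases}$$ 3) for $r+1\le j\le r+s$: $$\hat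 B_j=\begin{cases}A_j,&B_j=0\\ I_j(0,1),&B_j=I_j(0,1)\\ I_j(1,0),&B_j=I_j(1,0)\\ I_j(x_j,1),&B_j=I_j(-x_j,1)\\ 0,&B_j=A_j.\end{cases}$$
   Context: $D_n=\langle a,b\mid a^n=1,\ b^2=1,\ bab=a^{-1}\rangle$ is the dihedral group of order $2n$, $\mathbb{F}_qD_n$ its group algebra; every element is uniquely $P(a)+bQ(a)$ with $P,Q\in\mathbb{F}_q[x]$ of degree less than $n$. A dihedral code ($D_n$-code) is a left ideal of $\mathbb{F}_qD_n$. The dot product on $\mathbb{F}_qD_n$ is $\left(\sum_g x_gg,\sum_g y_gg\right)\mapsto\sum_{g\in D_n}x_gy_g\in\mathbb{F}_q$, and the dual code of $C$ is $C^\perp=\{x\in\mathbb{F}_qD_n\mid \text{the dot product of } c \text{ and } x \text{ is } 0 \text{ for all } c\in C\}$. For $g\in\mathbb{F}_q[x]$ with $g(0)\neq0$ put $g^*(x)=x^{\deg g}g(x^{-1})$. Factor $x^n-1$ over $\mathbb{F}_q$ into (pairwise distinct) monic irreducible factors as $x^n-1=(f_1f_2\cdots f_r)(f_{r+1}f_{r+1}^*\cdots f_{r+s}f_{r+s}^* )$, where $f_1=x-1$, $f_2=x+1$ if $n$ is even, $f_j^*=f_j$ for $1<j\le r$, and for $j>r$ the polynomials $f_j$ and $f_j^*$ have different roots (here the factor $f_j^*$, $j>r$, is normalized by a scalar to be monic). Let $\alpha_j$ be a root of $f_j$. Let $\zeta(n)=1$ if $n$ is odd, $\zeta(n)=2$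 if $n$ is even. $\langle h\mid h^2\rangle$ is the cyclic group of order 2 generated by $h$. Put $F_j=\mathbb{F}_q$ for $1\le j\le\zeta(n)$, $F_j=\mathbb{F}_q[\alpha_j+\alpha_j^{-1}]$ for $\zeta(n)+1\le j\le r$, $F_j=\mathbb{F}_q[\alpha_j]$ for $r+1\le j\le r+s$. Put $A_j=\mathbb{F}_q\langle h\mid h^2\rangle$ for $1\le j\le\zeta(n)$ and $A_j=\mathrm{M}_2(F_j)$ for $\zeta(n)+1\le j\le r+s$. Define for $u=P(a)+bQ(a)$: $\gamma_1(u)=P(1)+Q(1)h$; $\gamma_2(u)=P(-1)+Q(-1)h$ (for $n$ even); for $j\ge\zeta(n)+1$, $\tau_j(u)=\begin{pmatrix}P(\alpha_j)&Q(\alpha_j^{-1})\\ Q(\alpha_j)&P(\alpha_j^{-1})\end{pmatrix}$; for $\zeta(n)+1\le j\le r$, $\sigma_j(X)=Z_j^{-1}XZ_j$ with $Z_j=\begin{pmatrix}1&-\alpha_j\\ 1&-\alpha_j^{-1}\end{pmatrix}$. Put $\mathcal{P}_j=\gamma_j$ for $j\le\zeta(n)$, $\mathcal{P}_j=\sigma_j\tau_j$ for $\zeta(n)+1\le j\le r$, $\mathcal{P}_j=\tau_j$ for $r+1\le j\le r+s$. It is known that $\mathcal{P}=\bigoplus_{j=1}^{r+s}\mathcal{P}_j:\mathbb{F}_qD_n\to\bigoplus_{j=1}^{r+s}A_j$ is an algebra isomorphism. For $x,y\in F_j$ put $I_j(x,y)=\mathbb{F}_q\langle h\mid h^2\rangle\left[(x+y)+(x-y)h\right]$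 for $1\le j\le\zeta(n)$, and $I_j(x,y)=\left\{\begin{pmatrix}ky & -kx \\ ty & -tx\end{pmatrix}\mid k,t\in F_j\right\}$ for $\zeta(n)+1\le j\le r+s$. Every dihedral code has an image under $\mathcal{P}$ of the form written in the claim. *)

theory Defs
  imports
    "HOL-Analysis.Cartesian_Space"
    "HOL-Algebra.Algebraic_Closure_Type"
    "HOL-Algebra.Elementary_Groups"
begin

section \<open>Dihedral groups and group algebras\<close>

text \<open>The pair \<open>(e, i)\<close> stands for \<open>b\<^sup>e a\<^sup>i\<close> with \<open>i < n\<close>; the multiplication comes from
  \<open>a\<^sup>i b = b a\<^sup>-\<^sup>i\<close>.\<close>

definition dihedral_group :: "nat \<Rightarrow> (bool \<times> nat) monoid" where
  "dihedral_group n =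
     \<lparr>carrier = UNIV \<times> {..<n},
      monoid.mult = (\<lambda>(e, i) (f, k). (e \<noteq> f, ((if f then n - i else i) + k) mod n)),
      one = (False, 0)\<rparr>"

abbreviation dihedral_a :: "nat \<Rightarrow> bool \<times> nat" where
  "dihedral_a n \<equiv> (False, 1 mod n)"

abbreviation dihedral_b :: "bool \<times> nat" where
  "dihedral_b \<equiv> (True, 0)"

text \<open>The group algebra over the subring \<open>K\<close> of a type, for a finite group \<open>G\<close>: coefficient functions
  extended by zero outside \<open>G\<close>, with convolution as product.\<close>

definition group_algebra ::
    "'k::comm_ring_1 set \<Rightarrow> 'g monoid \<Rightarrow> ('g \<Rightarrow> 'k) ring" where
  "group_algebra K G =
     \<lparr>carrier = {u. (\<forall>g\<in>carrier G. u g \<in> K) \<and> (\<forall>g. g \<notin> carrier G \<longrightarrow> u g = 0)},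
      monoid.mult = (\<lambda>u v g. if g \<in> carrier G
                       then \<Sum>h\<in>carrier G. u h * v (inv\<^bsub>G\<^esub> h \<otimes>\<^bsub>G\<^esub> g) else 0),
      one = (\<lambda>g. if g = \<one>\<^bsub>G\<^esub> then 1 else 0),
      ring.zero = (\<lambda>g. 0),
      add = (\<lambda>u v g. u g + v g)\<rparr>"

definition left_ideal :: "'b set \<Rightarrow> ('b, 'm) ring_scheme \<Rightarrow> bool" where
  "left_ideal I R \<longleftrightarrow>
     additive_subgroup I R \<and> (\<forall>x\<in>carrier R. \<forall>c\<in>I. x \<otimes>\<^bsub>R\<^esub> c \<in> I)"

abbreviation dihedral_algebra :: "nat \<Rightarrow> (bool \<times> nat \<Rightarrow> 'a::comm_ring_1) ring" where
  "dihedral_algebra n \<equiv> group_algebra UNIV (dihedral_group n)"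

definition dihedral_code :: "nat \<Rightarrow> (bool \<times> nat \<Rightarrow> 'a::comm_ring_1) set \<Rightarrow> bool" where
  "dihedral_code n C \<longleftrightarrow> left_ideal C (dihedral_algebra n)"

definition dot_product ::
    "nat \<Rightarrow> (bool \<times> nat \<Rightarrow> 'a::comm_ring_1) \<Rightarrow> (bool \<times> nat \<Rightarrow> 'a) \<Rightarrow> 'a" where
  "dot_product n u v = (\<Sum>g\<in>carrier (dihedral_group n). u g * v g)"

definition dual_code ::
    "nat \<Rightarrow> (bool \<times> nat \<Rightarrow> 'a::comm_ring_1) set \<Rightarrow> (bool \<times> nat \<Rightarrow> 'a) set" where
  "dual_code n C =
     {x \<in> carrier (dihedral_algebra n). \<forall>c\<in>C. dot_product n c x = 0}"

text \<open>The polynomials \<open>P\<close> and \<open>Q\<close> of degree less than \<open>n\<close> with \<open>u = P(a) + b Q(a)\<close>.\<close>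

definition rot_poly :: "nat \<Rightarrow> (bool \<times> nat \<Rightarrow> 'a::comm_ring_1) \<Rightarrow> 'a poly" where
  "rot_poly n u = (\<Sum>i<n. monom (u (False, i)) i)"

definition refl_poly :: "nat \<Rightarrow> (bool \<times> nat \<Rightarrow> 'a::comm_ring_1) \<Rightarrow> 'a poly" where
  "refl_poly n u = (\<Sum>i<n. monom (u (True, i)) i)"

lemma coeff_rot_poly: "coeff (rot_poly n u) i = (if i < n then u (False, i) else 0)"
  and coeff_refl_poly: "coeff (refl_poly n u) i = (if i < n then u (True, i) else 0)"
  by (simp_all add: rot_poly_def refl_poly_def coeff_sum sum.delta)

lemma inv_dihedral_aux:
  assumes "i < (n::nat)"
  shows "((n - i) mod n + i) mod n = 0"
  using assms by (simp add: mod_add_left_eq)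

lemma group_dihedral_group:
  assumes "n > 0"
  shows "group (dihedral_group n)"
proof (rule groupI)
  show "x \<otimes>\<^bsub>dihedral_group n\<^esub> y \<otimes>\<^bsub>dihedral_group n\<^esub> z =
        x \<otimes>\<^bsub>dihedral_group n\<^esub> (y \<otimes>\<^bsub>dihedral_group n\<^esub> z)"
    if xyz_in: "x \<in> carrier (dihedral_group n)" "y \<in> carrier (dihedral_group n)"
       "z \<in> carrier (dihedral_group n)" for x y z
  proof -
    obtain e i f k g l where xyz: "x = (e, i)" "y = (f, k)" "z = (g, l)"
      and lt: "i < n" "k < n" "l < n"
      using xyz_in by (cases x; cases y; cases z) (auto simp: dihedral_group_def)
    have neg: "int ((n - m mod n + l) mod n) = (int l - int m) mod int n" for m
    proof -
      have "int (n - m mod n) = int n - int m mod int n"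
        using assms by (simp add: of_nat_diff zmod_int order_less_imp_le)
      then have eq: "int (n - m mod n) + int l = int n + (int l - int m mod int n)"
        by simp
      have "int ((n - m mod n + l) mod n) = (int n + (int l - int m mod int n)) mod int n"
        by (simp only: zmod_int of_nat_add eq)
      also have "\<dots> = (int l - int m mod int n) mod int n"
        by (rule mod_add_self1)
      finally show ?thesis by (simp add: mod_diff_right_eq)
    qed
    have "int (((if g then n - ((if f then n - i else i) + k) mod n
                      else ((if f then n - i else i) + k) mod n) + l) mod n) =
          int (((if f \<noteq> g then n - i else i) + ((if g then n - k else k) + l) mod n) mod n)"
    proof (cases g)
      case True
      have 1: "int (((if f \<noteq> g then n - i else i) + ((if g then n - k else k) + l) mod n) mod n)
             = (int (if f then i else n - i) + (int (n - k) + int l)) mod int n"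
        using True by (simp add: zmod_int mod_add_right_eq)
      have 2: "int (n - k) = int n - int k" "int (n - i) = int n - int i"
        using lt by (simp_all add: of_nat_diff)
      show ?thesis
      proof (cases f)
        case True
        have "(int i + (int n - int k + int l)) mod int n =
              (int l - (int n + int k - int i)) mod int n"
          by (rule mod_eq_dvd_iff[THEN iffD2], rule dvdI[of _ _ 2]) (simp add: algebra_simps)
        then show ?thesis using \<open>g\<close> True 2 1 neg by simp
      next
        case False
        have "(int n - int i + (int n - int k + int l)) mod int n =
              (int l - (int i + int k)) mod int n"
          by (rule mod_eq_dvd_iff[THEN iffD2], rule dvdI[of _ _ 2]) (simp add: algebra_simps)
        then show ?thesis using \<open>g\<close> False 2 1 neg by simp
      qed
    next
      case False
      then show ?thesis by (simp add: mod_add_left_eq mod_add_right_eq add.assoc)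
    qed
    then show ?thesis
      unfolding xyz by (auto simp: dihedral_group_def simp flip: of_nat_eq_iff)
  qed
  show "\<exists>y\<in>carrier (dihedral_group n). y \<otimes>\<^bsub>dihedral_group n\<^esub> x = \<one>\<^bsub>dihedral_group n\<^esub>"
    if "x \<in> carrier (dihedral_group n)" for x
  proof (cases x)
    case (Pair e i)
    then have i: "i < n" using that by (simp add: dihedral_group_def)
    show ?thesis
      by (rule bexI[of _ "(e, if e then i else (n - i) mod n)"])
         (use i assms inv_dihedral_aux[of i n] in \<open>auto simp: Pair dihedral_group_def\<close>)
  qed
qed (use assms in \<open>auto simp: dihedral_group_def\<close>)

lemma card_dihedral_group: "card (carrier (dihedral_group n)) = 2 * n"
  by (simp add: dihedral_group_def card_cartesian_product)

lemma dihedral_a_pow: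
  assumes "n > 0"
  shows "dihedral_a n [^]\<^bsub>dihedral_group n\<^esub> (k::nat) = (False, k mod n)"
proof (induction k)
  case 0
  then show ?case using assms by (simp add: nat_pow_def dihedral_group_def)
next
  case (Suc k)
  then show ?case
    by (simp add: nat_pow_def dihedral_group_def mod_add_left_eq mod_add_right_eq mod_simps)
qed

lemma dihedral_relations:
  assumes "n > 0"
  shows "dihedral_a n [^]\<^bsub>dihedral_group n\<^esub> n = \<one>\<^bsub>dihedral_group n\<^esub>"
    and "dihedral_b \<otimes>\<^bsub>dihedral_group n\<^esub> dihedral_b = \<one>\<^bsub>dihedral_group n\<^esub>"
    and "dihedral_b \<otimes>\<^bsub>dihedral_group n\<^esub> dihedral_a n \<otimes>\<^bsub>dihedral_group n\<^esub> dihedral_b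
           = inv\<^bsub>dihedral_group n\<^esub> (dihedral_a n)"
    and "i < n \<Longrightarrow> (e, i) = (if e then dihedral_b else \<one>\<^bsub>dihedral_group n\<^esub>) \<otimes>\<^bsub>dihedral_group n\<^esub>
           dihedral_a n [^]\<^bsub>dihedral_group n\<^esub> i"
proof -
  interpret group "dihedral_group n" using assms by (rule group_dihedral_group)
  show "dihedral_a n [^]\<^bsub>dihedral_group n\<^esub> n = \<one>\<^bsub>dihedral_group n\<^esub>"
    using assms by (simp only: dihedral_a_pow mod_self) (simp add: dihedral_group_def)
  show "dihedral_b \<otimes>\<^bsub>dihedral_group n\<^esub> dihedral_b = \<one>\<^bsub>dihedral_group n\<^esub>"
    by (simp add: dihedral_group_def)
  have "1 mod n < n" using assms by simp
  then show "dihedral_b \<otimes>\<^bsub>dihedral_group n\<^esub> dihedral_a n \<otimes>\<^bsub>dihedral_group n\<^esub> dihedral_b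
           = inv\<^bsub>dihedral_group n\<^esub> (dihedral_a n)"
    using assms inv_dihedral_aux[of "1 mod n" n]
    by (intro inv_equality[symmetric]) (auto simp: dihedral_group_def)
  show "i < n \<Longrightarrow> (e, i) = (if e then dihedral_b else \<one>\<^bsub>dihedral_group n\<^esub>) \<otimes>\<^bsub>dihedral_group n\<^esub>
           dihedral_a n [^]\<^bsub>dihedral_group n\<^esub> i"
    using assms by (simp only: dihedral_a_pow) (simp add: dihedral_group_def)
qed


section \<open>The decomposition of the dihedral group algebra\<close>

text \<open>\<open>reflect_poly g\<close> is \<open>x\<^sup>d g(x\<^sup>-\<^sup>1)\<close> with \<open>d = degree g\<close>; its leading coefficient is
  \<open>g(0)\<close> when \<open>g(0) \<noteq> 0\<close>.\<close>

definition monic_reciprocal :: "'a::field poly \<Rightarrow> 'a poly" where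
  "monic_reciprocal g = smult (inverse (coeff g 0)) (reflect_poly g)"

definition \<zeta> :: "nat \<Rightarrow> nat" where
  "\<zeta> n = (if odd n then 1 else 2)"

text \<open>All extensions of the ground field are taken inside its algebraic closure.\<close>

definition ev :: "'a::field poly \<Rightarrow> 'a alg_closure \<Rightarrow> 'a alg_closure" where
  "ev p t = poly (map_poly to_ac p) t"

definition adjoin :: "'a::field alg_closure \<Rightarrow> 'a alg_closure set" where
  "adjoin t = range (\<lambda>p :: 'a poly. ev p t)"

definition coeff_field ::
    "nat \<Rightarrow> nat \<Rightarrow> (nat \<Rightarrow> 'a::field alg_closure) \<Rightarrow> nat \<Rightarrow> 'a alg_closure set" where
  "coeff_field n r \<alpha> j =
     (if j \<le> \<zeta> n then range to_ac
      else if j \<le> r then adjoin (\<alpha> j + inverse (\<alpha> j))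
      else adjoin (\<alpha> j))"

text \<open>\<open>integer_mod_group 2\<close> serves as the cyclic group \<open>{1, h}\<close>, with \<open>h\<close> the residue \<open>1\<close>.
  An element of a summand is a group algebra element (\<open>Inl\<close>) or a matrix (\<open>Inr\<close>).\<close>

type_synonym 'k summand = "(int \<Rightarrow> 'k) + 'k^2^2"

definition c2_elem :: "'k::comm_ring_1 \<Rightarrow> 'k \<Rightarrow> int \<Rightarrow> 'k" where
  "c2_elem x y = (\<lambda>g. if g = 0 then x else if g = 1 then y else 0)"

definition mat22 :: "'k::zero \<Rightarrow> 'k \<Rightarrow> 'k \<Rightarrow> 'k \<Rightarrow> 'k^2^2" where
  "mat22 p q s t = vector [vector [p, q], vector [s, t]]"

definition summand_algebra ::
    "nat \<Rightarrow> nat \<Rightarrow> (nat \<Rightarrow> 'a::field alg_closure) \<Rightarrow> nat \<Rightarrow> 'a alg_closure summand set" where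
  "summand_algebra n r \<alpha> j =
     (if j \<le> \<zeta> n then Inl ` carrier (group_algebra (coeff_field n r \<alpha> j) (integer_mod_group 2))
      else Inr ` {M. \<forall>i k. vec_nth (vec_nth M i) k \<in> coeff_field n r \<alpha> j})"

definition summand_zero :: "nat \<Rightarrow> nat \<Rightarrow> 'a::field alg_closure summand set" where
  "summand_zero n j = (if j \<le> \<zeta> n then {Inl (\<lambda>g. 0)} else {Inr 0})"

text \<open>The library's \<open>PIdl\<^bsub>R\<^esub> v\<close> is \<open>{w v | w \<in> R}\<close>.\<close>

definition summand_ideal ::
    "nat \<Rightarrow> nat \<Rightarrow> (nat \<Rightarrow> 'a::field alg_closure) \<Rightarrow> nat \<Rightarrow> 'a alg_closure \<Rightarrow> 'a alg_closure
       \<Rightarrow> 'a alg_closure summand set" where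
  "summand_ideal n r \<alpha> j x y =
     (if j \<le> \<zeta> n then
        Inl ` (PIdl\<^bsub>group_algebra (coeff_field n r \<alpha> j) (integer_mod_group 2)\<^esub> (c2_elem (x + y) (x - y)))
      else
        Inr ` {mat22 (k * y) (- k * x) (t * y) (- t * x) | k t.
                 k \<in> coeff_field n r \<alpha> j \<and> t \<in> coeff_field n r \<alpha> j})"

definition \<gamma> :: "nat \<Rightarrow> nat \<Rightarrow> (bool \<times> nat \<Rightarrow> 'a::field) \<Rightarrow> int \<Rightarrow> 'a alg_closure" where
  "\<gamma> n j u = (let c = (if j = 1 then 1 else - 1)
               in c2_elem (ev (rot_poly n u) c) (ev (refl_poly n u) c))"

definition \<tau> :: "nat \<Rightarrow> 'a::field alg_closure \<Rightarrow> (bool \<times> nat \<Rightarrow> 'a) \<Rightarrow> 'a alg_closure^2^2" where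
  "\<tau> n t u = mat22 (ev (rot_poly n u) t) (ev (refl_poly n u) (inverse t))
                    (ev (refl_poly n u) t) (ev (rot_poly n u) (inverse t))"

definition \<sigma> :: "'a::field alg_closure \<Rightarrow> 'a alg_closure^2^2 \<Rightarrow> 'a alg_closure^2^2" where
  "\<sigma> t M = (let Z = mat22 1 (- t) 1 (- inverse t) in matrix_inv Z ** M ** Z)"

definition proj ::
    "nat \<Rightarrow> nat \<Rightarrow> (nat \<Rightarrow> 'a::field alg_closure) \<Rightarrow> nat \<Rightarrow> (bool \<times> nat \<Rightarrow> 'a)
       \<Rightarrow> 'a alg_closure summand" where
  "proj n r \<alpha> j u =
     (if j \<le> \<zeta> n then Inl (\<gamma> n j u)
      else if j \<le> r then Inr (\<sigma> (\<alpha> j) (\<tau> n (\<alpha> j) u))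
      else Inr (\<tau> n (\<alpha> j) u))"

text \<open>Elements of a direct sum over \<open>{1..r + s}\<close> are extensional functions on that index set.\<close>

definition decomp ::
    "nat \<Rightarrow> nat \<Rightarrow> nat \<Rightarrow> (nat \<Rightarrow> 'a::field alg_closure) \<Rightarrow> (bool \<times> nat \<Rightarrow> 'a)
       \<Rightarrow> nat \<Rightarrow> 'a alg_closure summand" where
  "decomp n r s \<alpha> u = (\<lambda>j\<in>{1..r + s}. proj n r \<alpha> j u)"

text \<open>The component of the dual code, in terms of the component \<open>B\<close> of the code; \<open>x\<close> is only
  relevant when \<open>B\<close> is the ideal with parameters \<open>(- x, 1)\<close>.
  The ideals compared with \<open>B\<close> are pairwise different, except that in characteristic 2 the ideals
  with parameters \<open>(1, 0)\<close> and \<open>(0, 1)\<close> agree for \<open>j = 1\<close>, where both cases give the same result.\<close>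

definition dual_summand ::
    "nat \<Rightarrow> nat \<Rightarrow> (nat \<Rightarrow> 'a::field alg_closure) \<Rightarrow> nat \<Rightarrow> 'a alg_closure
       \<Rightarrow> 'a alg_closure summand set \<Rightarrow> 'a alg_closure summand set" where
  "dual_summand n r \<alpha> j x B =
     (let I = summand_ideal n r \<alpha> j; c = \<alpha> j + inverse (\<alpha> j) in
      if B = summand_zero n j then summand_algebra n r \<alpha> j
      else if B = summand_algebra n r \<alpha> j then summand_zero n j
      else if j \<le> \<zeta> n then
        (if B = I 1 0 then I 0 1
         else if B = I 0 1 then I 1 0
         else undefined)
      else if j \<le> r then
        (if B = I 1 0 then I c 2
         else if B = I 0 1 then I 2 c
         else if B = I (- x) 1 then I (2 + c * x) (c + 2 * x)
         else undefined)
      else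
        (if B = I 0 1 then I 0 1
         else if B = I 1 0 then I 1 0
         else if B = I (- x) 1 then I x 1
         else undefined))"

end

theory Submission
  imports Defs "HOL-Number_Theory.Residues"
begin

text \<open>
  The dual code is first turned into an annihilator. Let \<open>c\<^sup>T\<close> be the image of \<open>c\<close> under
  \<open>g \<mapsto> g\<^sup>-\<^sup>1\<close>. The coefficient of \<open>u c\<^sup>T\<close> at \<open>g\<close> is the dot product of \<open>u\<close> with the left
  translate \<open>g c\<close>, and a left ideal contains the translates of its elements; hence \<open>u\<close> is in the
  dual of \<open>I\<close> if and only if \<open>u c\<^sup>T = 0\<close> for all \<open>c \<in> I\<close> (\<open>mem_dual_code_iff_correlation\<close>).

  For an \<open>n\<close>-th root of unity \<open>t\<close>, the matrix \<open>\<tau> n t u\<close> is the value at \<open>u\<close> of a two-dimensional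
  representation of the dihedral group, and inversion in the group becomes reflection of the matrix
  in its antidiagonal. So \<open>\<tau>\<close> sends \<open>u c\<^sup>T\<close> to the product of \<open>\<tau> n t u\<close> with the antitranspose of
  \<open>\<tau> n t c\<close> (\<open>tau_correlation\<close>). A polynomial of degree less than \<open>n\<close> that vanishes at a root of
  every irreducible factor of \<open>x\<^sup>n - 1\<close> is zero, and since \<open>x\<^sup>n - 1\<close> has simple roots the values at
  one root of each factor can be prescribed. The first fact lets \<open>u c\<^sup>T = 0\<close> be tested in each
  component separately (\<open>eq_0_if_all_tau_eq_0\<close>); the second, together with the explicit shape of
  the components, makes \<open>decomp\<close> surjective (\<open>decomp_surj\<close>). Consequently the image of the dual is
  the product of the annihilators of the antitransposed components of the code.

  What remains is linear algebra in one component. The ideal with parameters \<open>(x, y)\<close> consists of the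
  matrices whose rows are multiples of \<open>(y, -x)\<close>. For \<open>j > r\<close> the antitransposed matrices are used
  as they stand, and the rows that annihilate them are the multiples of \<open>(y, x)\<close>. For a
  self-reciprocal factor the conjugation \<open>\<sigma>\<close> intervenes: up to a nonzero scalar it inserts the
  symmetric matrix with diagonal entries \<open>\<alpha> + \<alpha>\<^sup>-\<^sup>1\<close> and off-diagonal entries \<open>2\<close> between the two
  factors (\<open>product_eq_0_iff_sigma\<close>), which is where these two numbers in the result come from.
  Both cases are instances of \<open>mat_perp_row_ideal\<close>. For \<open>j \<le> \<zeta> n\<close> the statement is that \<open>1 + h\<close> and
  \<open>1 - h\<close> generate each other's annihilators in the group algebra of \<open>{1, h}\<close> (\<open>summand_perp_c2\<close>).
\<close>


section \<open>Evaluation and simple extensions\<close>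

lemma ev_add [simp]: "ev (p + q) t = ev p t + ev q t"
proof -
  have "map_poly to_ac (p + q) = map_poly to_ac p + map_poly to_ac q"
    by (rule poly_eqI) (simp add: coeff_map_poly)
  then show ?thesis by (simp add: ev_def)
qed

lemma ev_minus [simp]: "ev (- p) t = - ev p t"
proof -
  have "map_poly to_ac (- p) = - map_poly to_ac p"
    by (rule poly_eqI) (simp add: coeff_map_poly)
  then show ?thesis by (simp add: ev_def)
qed

lemma ev_diff [simp]: "ev (p - q) t = ev p t - ev q t"
  using ev_add[of p "- q" t] by simp

lemma ev_mult [simp]: "ev (p * q) t = ev p t * ev q t"
proof -
  have "map_poly to_ac (p * q) = map_poly to_ac p * map_poly to_ac q"
    by (rule poly_eqI) (simp add: coeff_map_poly coeff_mult to_ac_sum)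
  then show ?thesis by (simp add: ev_def)
qed

lemma ev_0 [simp]: "ev 0 t = 0" and ev_1 [simp]: "ev 1 t = 1"
  by (simp_all add: ev_def)

lemma ev_const [simp]: "ev [:c:] t = to_ac c"
  by (simp add: ev_def map_poly_pCons)

lemma ev_pCons: "ev (pCons c p) t = to_ac c + t * ev p t"
  by (simp add: ev_def map_poly_pCons)

lemma ev_monom [simp]: "ev (monom c i) t = to_ac c * t ^ i"
  by (simp add: ev_def map_poly_monom poly_monom)

lemma ev_smult [simp]: "ev (smult c p) t = to_ac c * ev p t"
  using ev_mult[of "[:c:]" p t] by simp

lemma ev_sum: "ev (\<Sum>i\<in>A. p i) t = (\<Sum>i\<in>A. ev (p i) t)"
  by (induction A rule: infinite_finite_induct) simp_all

lemma ev_prod: "ev (\<Prod>i\<in>A. p i) t = (\<Prod>i\<in>A. ev (p i) t)"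
  by (induction A rule: infinite_finite_induct) simp_all

lemma ev_pcompose: "ev (pcompose p q) t = ev p (ev q t)"
  by (induction p) (simp_all add: pcompose_pCons ev_pCons)

lemma degree_map_poly_to_ac: "degree (map_poly to_ac p) = degree p"
  by (cases "p = 0") (auto intro!: map_poly_degree_eq)

lemma ev_reflect_poly: "t \<noteq> 0 \<Longrightarrow> ev (reflect_poly p) t = t ^ degree p * ev p (inverse t)"
proof -
  assume "t \<noteq> 0"
  have "map_poly to_ac (reflect_poly p) = reflect_poly (map_poly to_ac p)"
    by (rule poly_eqI) (simp add: coeff_map_poly coeff_reflect_poly degree_map_poly_to_ac)
  then show ?thesis
    using \<open>t \<noteq> 0\<close> by (simp add: ev_def poly_reflect_poly_nz degree_map_poly_to_ac)
qed

text \<open>A subset of a field that is a field itself. The coefficient fields \<open>F\<^sub>j\<close> are subsets of one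
  algebraic closure, so a predicate on sets is all that the linear algebra over them requires.\<close>

definition subfield_of :: "'k::field set \<Rightarrow> bool" where
  "subfield_of F \<longleftrightarrow> 1 \<in> F \<and> (\<forall>x\<in>F. \<forall>y\<in>F. x - y \<in> F \<and> x * y \<in> F) \<and> (\<forall>x\<in>F. inverse x \<in> F)"

lemma subfield_ofD:
  assumes "subfield_of F"
  shows "1 \<in> F" "0 \<in> F" "x \<in> F \<Longrightarrow> y \<in> F \<Longrightarrow> x - y \<in> F" "x \<in> F \<Longrightarrow> y \<in> F \<Longrightarrow> x * y \<in> F"
    "x \<in> F \<Longrightarrow> inverse x \<in> F" "x \<in> F \<Longrightarrow> - x \<in> F" "x \<in> F \<Longrightarrow> y \<in> F \<Longrightarrow> x + y \<in> F"
    "x \<in> F \<Longrightarrow> y \<in> F \<Longrightarrow> x / y \<in> F" "of_nat k \<in> F" "numeral w \<in> F"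
proof -
  show one: "1 \<in> F" and diff: "\<And>x y. x \<in> F \<Longrightarrow> y \<in> F \<Longrightarrow> x - y \<in> F"
    and mult: "\<And>x y. x \<in> F \<Longrightarrow> y \<in> F \<Longrightarrow> x * y \<in> F" and inv: "\<And>x. x \<in> F \<Longrightarrow> inverse x \<in> F"
    using assms by (auto simp: subfield_of_def)
  show zero: "0 \<in> F" using diff[OF one one] by simp
  show neg: "\<And>x. x \<in> F \<Longrightarrow> - x \<in> F" using diff[OF zero] by simp
  show add: "\<And>x y. x \<in> F \<Longrightarrow> y \<in> F \<Longrightarrow> x + y \<in> F" using diff neg by fastforce
  show "x \<in> F \<Longrightarrow> y \<in> F \<Longrightarrow> x / y \<in> F" using mult inv by (simp add: divide_inverse)
  show of_nat: "of_nat k \<in> F" for k by (induction k) (simp_all add: zero one add)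
  show "numeral w \<in> F" using of_nat[of "numeral w"] by simp
qed

lemma sum_in_subfield_of:
  assumes "subfield_of F" "\<And>i. i \<in> A \<Longrightarrow> g i \<in> F"
  shows "sum g A \<in> F"
  using assms(2) by (induction A rule: infinite_finite_induct)
    (simp_all add: subfield_ofD(2,7)[OF assms(1)])

lemma adjoinI [intro]: "ev p t \<in> adjoin t"
  by (simp add: adjoin_def)

lemma generator_in_adjoin: "t \<in> adjoin t"
  using adjoinI[of "[:0, 1:]" t] by (simp add: ev_pCons)

lemma to_ac_in_adjoin: "to_ac c \<in> adjoin t"
  using adjoinI[of "[:c:]" t] by simp

lemma adjoin_subset: "z \<in> adjoin t \<Longrightarrow> adjoin z \<subseteq> adjoin t"
  by (auto simp: adjoin_def ev_pcompose[symmetric])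

text \<open>Powers of \<open>t\<close> may be reduced modulo \<open>n\<close>, so every polynomial in \<open>t\<close> has one with exponents
  below \<open>n\<close>, and there are finitely many choices of coefficients.\<close>

lemma finite_adjoin_root_of_unity:
  fixes t :: "'a::{field, finite} alg_closure"
  assumes "t ^ n = 1" "n > 0"
  shows "finite (adjoin t)"
proof -
  have "ev p t \<in> (\<lambda>c. \<Sum>i<n. to_ac (c i) * t ^ i) ` ({..<n} \<rightarrow>\<^sub>E UNIV)" for p :: "'a poly"
  proof (induction p)
    case 0
    show ?case
      by (rule image_eqI[of _ _ "\<lambda>i\<in>{..<n}. 0"]) auto
  next
    case (pCons a p)
    then obtain c where c: "ev p t = (\<Sum>i<n. to_ac (c i) * t ^ i)" by auto
    define m where "m = n - 1"
    have m: "n = Suc m" using assms(2) by (simp add: m_def)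
    \<comment> \<open>Multiplication by \<open>t\<close> shifts the coefficients cyclically, because \<open>t\<^sup>n = 1\<close>.\<close>
    define c' where "c' i = (case i of 0 \<Rightarrow> a + c m | Suc k \<Rightarrow> c k)" for i
    have "ev (pCons a p) t = to_ac a + (\<Sum>i<m. to_ac (c i) * t ^ Suc i) + to_ac (c m) * t ^ n"
      by (simp add: ev_pCons c m sum_distrib_left algebra_simps)
    also have "\<dots> = (\<Sum>i<n. to_ac (c' i) * t ^ i)"
      unfolding m sum.lessThan_Suc_shift using assms(1) by (simp add: c'_def m algebra_simps)
    finally show ?case
      by (intro image_eqI[of _ _ "restrict c' {..<n}"]) auto
  qed
  then have "adjoin t \<subseteq> (\<lambda>c. \<Sum>i<n. to_ac (c i) * t ^ i) ` ({..<n} \<rightarrow>\<^sub>E UNIV)"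
    by (auto simp: adjoin_def)
  then show ?thesis
    by (rule finite_subset) (intro finite_imageI finite_PiE; simp)
qed

text \<open>In a finite set the powers of \<open>z \<noteq> 0\<close> repeat, so some positive power of \<open>z\<close> is \<open>1\<close> and the
  inverse of \<open>z\<close> is itself a power of \<open>z\<close>.\<close>

lemma subfield_of_adjoin:
  assumes "finite (adjoin t)"
  shows "subfield_of (adjoin t)"
  unfolding subfield_of_def
proof (intro conjI ballI)
  show "1 \<in> adjoin t" using adjoinI[of 1 t] by simp
  show "x - y \<in> adjoin t" "x * y \<in> adjoin t" if "x \<in> adjoin t" "y \<in> adjoin t" for x y
    using that by (auto simp: adjoin_def simp flip: ev_diff ev_mult)
  show "inverse z \<in> adjoin t" if z: "z \<in> adjoin t" for z
  proof (cases "z = 0")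
    case True
    then show ?thesis using adjoinI[of 0 t] by simp
  next
    case False
    have pow: "z ^ k \<in> adjoin t" for k
    proof -
      obtain p where "z = ev p t" using z by (auto simp: adjoin_def)
      then have "z ^ k = ev (p ^ k) t" by (induction k) simp_all
      then show ?thesis by (simp only: adjoinI)
    qed
    then have "range (\<lambda>k::nat. z ^ k) \<subseteq> adjoin t" by auto
    then have "\<not> inj (\<lambda>k::nat. z ^ k)"
      using assms finite_subset finite_imageD infinite_UNIV_nat by blast
    then obtain i k :: nat where ik: "i < k" "z ^ i = z ^ k"
      by (metis injI linorder_neqE_nat)
    have "z * z ^ (k - i - 1) = z ^ (k - i)"
      using ik(1) by (simp add: Suc_diff_Suc flip: power_Suc)
    moreover have "z ^ i * z ^ (k - i) = z ^ i * 1"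
      using ik(2) power_add[of z i "k - i"] ik(1) by simp
    ultimately have "z * z ^ (k - i - 1) = 1" using False by simp
    then have "inverse z = z ^ (k - i - 1)" by (rule inverse_unique)
    then show ?thesis using pow by simp
  qed
qed

text \<open>Polynomials vanishing at \<open>t\<close> are multiples of one of least degree, and the irreducible \<open>g\<close> can
  only differ from that one by a unit. This transports a relation between polynomials from one root
  of \<open>g\<close> to all others.\<close>

lemma irreducible_dvd_if_common_root:
  fixes g P :: "'a::field poly"
  assumes "irreducible g" "ev g t = 0" "ev P t = 0"
  shows "g dvd P"
proof -
  have g0: "g \<noteq> 0" using assms(1) by auto
  define m where "m = (ARG_MIN degree m. m \<noteq> 0 \<and> ev m t = 0)"
  have m: "m \<noteq> 0 \<and> ev m t = 0" and min: "\<And>p. p \<noteq> 0 \<Longrightarrow> ev p t = 0 \<Longrightarrow> degree m \<le> degree p"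
    unfolding m_def
    using arg_min_nat_lemma[of "\<lambda>m. m \<noteq> 0 \<and> ev m t = 0" g degree] g0 assms(2) by auto
  have dvd: "m dvd p" if "ev p t = 0" for p
  proof -
    have "ev (p mod m) t = ev p t - ev (p div m) t * ev m t"
      by (simp flip: ev_mult ev_diff add: minus_div_mult_eq_mod)
    then have "ev (p mod m) t = 0" using m that by simp
    then have "p mod m = 0"
      using min[of "p mod m"] degree_mod_less[of m p] m by force
    then show ?thesis by auto
  qed
  obtain k where k: "g = m * k" using dvd[OF assms(2)] by auto
  have "\<not> is_unit m"
    using m by (auto simp: is_unit_poly_iff)
  then have "is_unit k" using irreducibleD[OF assms(1) k] by simp
  then have "g dvd m" using k by (simp add: mult_unit_dvd_iff)
  then show ?thesis using dvd[OF assms(3)] by (rule dvd_trans)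
qed

text \<open>A factorization of the reflected polynomial reflects back to one of \<open>g\<close>; the condition on the
  constant coefficient keeps degrees unchanged.\<close>

lemma irreducible_reflect_poly:
  fixes g :: "'a::field poly"
  assumes "irreducible g" "coeff g 0 \<noteq> 0"
  shows "irreducible (reflect_poly g)"
proof (rule irreducibleI)
  show "reflect_poly g \<noteq> 0" using assms by auto
  show "\<not> is_unit (reflect_poly g)"
    using assms by (auto simp: is_unit_iff_degree irreducible_def dest: degree_reflect_poly_eq)
  fix a b assume ab: "reflect_poly g = a * b"
  then have "coeff a 0 * coeff b 0 = lead_coeff g"
    by (metis coeff_0_reflect_poly coeff_mult_0)
  then have nz: "coeff a 0 \<noteq> 0" "coeff b 0 \<noteq> 0" using assms(1) by auto
  have "g = reflect_poly a * reflect_poly b"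
    using ab assms(2) by (metis reflect_poly_mult reflect_poly_reflect_poly)
  then have "is_unit (reflect_poly a) \<or> is_unit (reflect_poly b)"
    using assms(1) irreducibleD by blast
  then show "is_unit a \<or> is_unit b"
  proof -
    have "a \<noteq> 0" "b \<noteq> 0" using nz by auto
    then show ?thesis
      using nz \<open>is_unit (reflect_poly a) \<or> is_unit (reflect_poly b)\<close>
      by (simp add: is_unit_iff_degree)
  qed
qed


section \<open>Two by two matrices\<close>

lemma mat22_nth [simp]:
  "vec_nth (vec_nth (mat22 p q s t) 1) 1 = p" "vec_nth (vec_nth (mat22 p q s t) 1) 2 = q"
  "vec_nth (vec_nth (mat22 p q s t) 2) 1 = s" "vec_nth (vec_nth (mat22 p q s t) 2) 2 = t"
  by (simp_all add: mat22_def)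

lemma mat22_eq_iff [simp]:
  "mat22 p q s t = mat22 p' q' s' t' \<longleftrightarrow> p = p' \<and> q = q' \<and> s = s' \<and> t = t'"
  by (metis mat22_nth)

lemma matrix_eq_iff_2:
  "M = N \<longleftrightarrow> vec_nth (vec_nth M 1) 1 = vec_nth (vec_nth N 1) 1
     \<and> vec_nth (vec_nth M 1) 2 = vec_nth (vec_nth N 1) 2
     \<and> vec_nth (vec_nth M 2) 1 = vec_nth (vec_nth N 2) 1
     \<and> vec_nth (vec_nth M 2) 2 = vec_nth (vec_nth N 2) 2"
  for M N :: "'k^2^2"
  by (auto simp: vec_eq_iff forall_2)

lemma mat22_cases:
  obtains p q s t where "M = mat22 p q s t"
  using that[of "vec_nth (vec_nth M 1) 1" "vec_nth (vec_nth M 1) 2"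
      "vec_nth (vec_nth M 2) 1" "vec_nth (vec_nth M 2) 2"]
  by (simp add: matrix_eq_iff_2)

lemma mat22_mult:
  "mat22 p q s t ** mat22 p' q' s' t' =
   mat22 (p * p' + q * s') (p * q' + q * t') (s * p' + t * s') (s * q' + t * t')"
  for p :: "'k::comm_ring_1"
  by (simp add: matrix_eq_iff_2 matrix_matrix_mult_def sum_2)

lemma mat_eq_mat22: "mat k = mat22 k 0 0 k"
  for k :: "'k::comm_ring_1"
  by (simp add: matrix_eq_iff_2 mat_def)

lemma zero_eq_mat22: "0 = mat22 0 0 0 (0 :: 'k::comm_ring_1)"
  by (simp add: matrix_eq_iff_2)

lemma sum_nth_nth: "vec_nth (vec_nth (\<Sum>x\<in>A. M x) i) k = (\<Sum>x\<in>A. vec_nth (vec_nth (M x) i) k)"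
  by (simp add: sum_component)

lemma sum_matrix_mult: "(\<Sum>x\<in>A. M x) ** N = (\<Sum>x\<in>A. M x ** N)"
  for N :: "'k::comm_ring_1^'l^'m"
  by (simp add: vec_eq_iff matrix_matrix_mult_def sum_distrib_right sum.swap[of _ UNIV A])

lemma matrix_mult_sum_right: "N ** (\<Sum>x\<in>A. M x) = (\<Sum>x\<in>A. N ** M x)"
  for N :: "'k::comm_ring_1^'l^'m"
  by (simp add: vec_eq_iff matrix_matrix_mult_def sum_distrib_left sum.swap[of _ UNIV A])

text \<open>Reflection in the antidiagonal. It reverses products, and for the representations below it
  corresponds to inversion in the group.\<close>

definition antitranspose :: "'k::zero^2^2 \<Rightarrow> 'k^2^2" where
  "antitranspose M = mat22 (vec_nth (vec_nth M 2) 2) (vec_nth (vec_nth M 1) 2)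
                           (vec_nth (vec_nth M 2) 1) (vec_nth (vec_nth M 1) 1)"

lemma antitranspose_mat22 [simp]: "antitranspose (mat22 p q s t) = mat22 t q s p"
  by (simp add: antitranspose_def)

lemma antitranspose_mult: "antitranspose (M ** N) = antitranspose N ** antitranspose M"
  for M :: "'k::comm_ring_1^2^2"
  by (cases M rule: mat22_cases; cases N rule: mat22_cases) (simp add: mat22_mult algebra_simps)

lemma antitranspose_sum: "antitranspose (\<Sum>x\<in>A. M x) = (\<Sum>x\<in>A. antitranspose (M x))"
  for M :: "'i \<Rightarrow> 'k::comm_ring_1^2^2"
  by (simp add: antitranspose_def matrix_eq_iff_2 sum_nth_nth)

lemma matrix_mult_zero [simp]:
  "M ** 0 = (0 :: 'k::comm_ring_1^'l^'m)" "0 ** N = (0 :: 'k::comm_ring_1^'l^'m)"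
  by (simp_all add: vec_eq_iff matrix_matrix_mult_def)

lemma antitranspose_zero [simp]: "antitranspose 0 = (0 :: 'k::comm_ring_1^2^2)"
  by (simp add: zero_eq_mat22)


section \<open>The two-dimensional representations of the dihedral group\<close>

text \<open>The representation with \<open>a \<mapsto> diag(t, t\<^sup>-\<^sup>1)\<close> and \<open>b\<close> mapped to the exchange of coordinates,
  evaluated at \<open>b\<^sup>e a\<^sup>i\<close>.\<close>

definition dihedral_rep :: "'k::field \<Rightarrow> bool \<times> nat \<Rightarrow> 'k^2^2" where
  "dihedral_rep t = (\<lambda>(e, i). if e then mat22 0 (inverse t ^ i) (t ^ i) 0
                               else mat22 (t ^ i) 0 0 (inverse t ^ i))"

lemma power_mod_root_of_unity: "t ^ n = 1 \<Longrightarrow> t ^ (k mod n) = t ^ k"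
  for t :: "'k::field"
proof -
  assume "t ^ n = 1"
  then have "t ^ (n * (k div n) + k mod n) = t ^ (k mod n)"
    by (simp only: power_add power_mult power_one mult_1)
  then show ?thesis by simp
qed

lemma power_root_of_unity_diff: "t ^ n = 1 \<Longrightarrow> i \<le> n \<Longrightarrow> t ^ (n - i) = inverse t ^ i"
  for t :: "'k::field"
proof -
  assume t: "t ^ n = 1" and i: "i \<le> n"
  have "t ^ i * t ^ (n - i) = 1" using t i by (simp flip: power_add)
  then show ?thesis by (metis inverse_unique power_inverse)
qed

lemma dihedral_rep_mult:
  assumes t: "t ^ n = 1" and gh: "g \<in> carrier (dihedral_group n)" "h \<in> carrier (dihedral_group n)"
  shows "dihedral_rep t (g \<otimes>\<^bsub>dihedral_group n\<^esub> h) = dihedral_rep t g ** dihedral_rep t h"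
proof -
  obtain e i f k where g: "g = (e, i)" "h = (f, k)" by fastforce
  have lt: "i \<le> n" "k \<le> n" using gh by (auto simp: g dihedral_group_def)
  have t': "inverse t ^ n = 1" using t by (simp add: power_inverse)
  note simps = power_mod_root_of_unity[OF t] power_mod_root_of_unity[OF t'] power_add
    power_root_of_unity_diff[OF t] power_root_of_unity_diff[OF t']
  have shift: "s ^ (n + k - i) = inverse s ^ i * s ^ k" if "s ^ n = 1" for s :: 'a
    using power_add[of s "n - i" k] lt power_root_of_unity_diff[OF that lt(1)] by simp
  show ?thesis
    using lt shift[OF t] shift[OF t'] by (cases e; cases f)
      (simp_all add: g dihedral_group_def dihedral_rep_def mat22_mult simps)
qed

text \<open>The antitranspose of each representing matrix is a right inverse of it, by inspection; the
  homomorphism property supplies a left inverse, and the two agree.\<close>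

lemma dihedral_rep_inv:
  assumes t: "t ^ n = 1" "n > 0" and g: "g \<in> carrier (dihedral_group n)"
  shows "dihedral_rep t (inv\<^bsub>dihedral_group n\<^esub> g) = antitranspose (dihedral_rep t g)"
proof -
  interpret group "dihedral_group n" using t(2) by (rule group_dihedral_group)
  let ?R = "dihedral_rep t"
  have "t \<noteq> 0" using t by (cases "t = 0") (simp_all add: power_0_left)
  then have right: "?R g ** antitranspose (?R g) = mat 1"
    by (cases g) (simp add: dihedral_rep_def mat22_mult mat_eq_mat22 power_inverse)
  have "?R (inv\<^bsub>dihedral_group n\<^esub> g) ** ?R g = mat 1"
    using g t by (simp flip: dihedral_rep_mult)
      (simp add: dihedral_rep_def dihedral_group_def mat_eq_mat22)
  then have "?R (inv\<^bsub>dihedral_group n\<^esub> g) ** (?R g ** antitranspose (?R g)) = antitranspose (?R g)"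
    by (simp add: matrix_mul_assoc)
  then show ?thesis by (simp add: right)
qed

lemma tau_eq_sum:
  "\<tau> n t u = (\<Sum>g\<in>carrier (dihedral_group n). mat (to_ac (u g)) ** dihedral_rep t g)"
proof -
  have split: "(\<Sum>g\<in>carrier (dihedral_group n). h g) = (\<Sum>i<n. h (False, i)) + (\<Sum>i<n. h (True, i))"
    for h :: "bool \<times> nat \<Rightarrow> 'a alg_closure^2^2"
    using sum.cartesian_product[of "\<lambda>e i. h (e, i)" "{..<n}" UNIV]
    by (simp add: UNIV_bool dihedral_group_def add.commute)
  show ?thesis
    unfolding split
    by (simp add: matrix_eq_iff_2 sum_nth_nth mat_eq_mat22 dihedral_rep_def mat22_mult \<tau>_def
        rot_poly_def refl_poly_def ev_sum)
qed


section \<open>The dual code as an annihilator\<close>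

text \<open>The product \<open>g c\<close> in the group algebra.\<close>

definition translate :: "nat \<Rightarrow> bool \<times> nat \<Rightarrow> (bool \<times> nat \<Rightarrow> 'a) \<Rightarrow> bool \<times> nat \<Rightarrow> 'a::comm_ring_1"
  where
  "translate n g c = (\<lambda>h. if h \<in> carrier (dihedral_group n)
                           then c (inv\<^bsub>dihedral_group n\<^esub> g \<otimes>\<^bsub>dihedral_group n\<^esub> h) else 0)"

text \<open>The element \<open>u c\<^sup>T\<close> of the group algebra, where \<open>c\<^sup>T\<close> is the image of \<open>c\<close> under
  \<open>g \<mapsto> g\<^sup>-\<^sup>1\<close>: its coefficient at \<open>g\<close> is \<open>\<Sum>\<^sub>h u(h) c(g\<^sup>-\<^sup>1 h)\<close>.\<close>

definition correlation ::
    "nat \<Rightarrow> (bool \<times> nat \<Rightarrow> 'a) \<Rightarrow> (bool \<times> nat \<Rightarrow> 'a) \<Rightarrow> bool \<times> nat \<Rightarrow> 'a::comm_ring_1" where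
  "correlation n u c = (\<lambda>g. if g \<in> carrier (dihedral_group n)
                             then dot_product n (translate n g c) u else 0)"

lemma finite_dihedral_group: "finite (carrier (dihedral_group n))"
  by (simp add: dihedral_group_def)

text \<open>A representation is multiplicative on the group algebra and turns \<open>g \<mapsto> g\<^sup>-\<^sup>1\<close> into the
  antitranspose. In the double sum this is the substitution \<open>k = g\<^sup>-\<^sup>1 h\<close>, i.e. \<open>g = h k\<^sup>-\<^sup>1\<close>.\<close>

lemma tau_correlation:
  assumes t: "t ^ n = 1" "n > 0"
  shows "\<tau> n t (correlation n u c) = \<tau> n t u ** antitranspose (\<tau> n t c)"
proof -
  interpret G: group "dihedral_group n" using t(2) by (rule group_dihedral_group)
  let ?G = "carrier (dihedral_group n)" and ?R = "dihedral_rep t"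
  let ?inv = "m_inv (dihedral_group n)"
  let ?c = "\<lambda>g. mat (to_ac (c g)) :: 'a alg_closure^2^2"
    and ?u = "\<lambda>g. mat (to_ac (u g)) :: 'a alg_closure^2^2"
  have scalar: "?c h ** M = M ** ?c h" for M h
    by (cases M rule: mat22_cases) (simp add: mat_eq_mat22 mat22_mult)
  have mat_mult: "mat (a * b) = mat a ** (mat b :: 'a alg_closure^2^2)" for a b
    by (simp add: mat_eq_mat22 mat22_mult)
  have mat_sum: "mat (\<Sum>h\<in>?G. a h) = (\<Sum>h\<in>?G. mat (a h) :: 'a alg_closure^2^2)" for a
    by (simp add: mat_eq_mat22 matrix_eq_iff_2 sum_nth_nth)
  have "\<tau> n t (correlation n u c) =
      (\<Sum>g\<in>?G. \<Sum>h\<in>?G. ?u h ** ?c (?inv g \<otimes>\<^bsub>dihedral_group n\<^esub> h) ** ?R g)"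
    unfolding tau_eq_sum
    by (intro sum.cong refl)
      (simp add: correlation_def dot_product_def translate_def to_ac_sum mat_sum mat_mult
        sum_matrix_mult mult.commute[of "to_ac (c _)"])
  also have "\<dots> = (\<Sum>h\<in>?G. \<Sum>g\<in>?G. ?u h ** ?c (?inv g \<otimes>\<^bsub>dihedral_group n\<^esub> h) ** ?R g)"
    by (rule sum.swap)
  also have "\<dots> = (\<Sum>h\<in>?G. \<Sum>k\<in>?G. ?u h ** ?c k ** ?R (h \<otimes>\<^bsub>dihedral_group n\<^esub> ?inv k))"
  proof (rule sum.cong[OF refl])
    fix h assume h: "h \<in> ?G"
    have cancel: "h \<otimes>\<^bsub>dihedral_group n\<^esub> (?inv h \<otimes>\<^bsub>dihedral_group n\<^esub> g) = g" if "g \<in> ?G" for g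
      using h that by (simp flip: G.m_assoc)
    show "(\<Sum>g\<in>?G. ?u h ** ?c (?inv g \<otimes>\<^bsub>dihedral_group n\<^esub> h) ** ?R g)
        = (\<Sum>k\<in>?G. ?u h ** ?c k ** ?R (h \<otimes>\<^bsub>dihedral_group n\<^esub> ?inv k))"
      by (rule sum.reindex_bij_witness[of _ "\<lambda>k. h \<otimes>\<^bsub>dihedral_group n\<^esub> ?inv k"
            "\<lambda>g. ?inv g \<otimes>\<^bsub>dihedral_group n\<^esub> h"])
        (use h in \<open>simp_all add: G.inv_mult_group G.m_assoc cancel\<close>)
  qed
  also have "\<dots> = (\<Sum>h\<in>?G. \<Sum>k\<in>?G. (?u h ** ?R h) ** antitranspose (?c k ** ?R k))"
  proof (intro sum.cong refl)
    fix h k assume hk: "h \<in> ?G" "k \<in> ?G"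
    have "antitranspose (?c k ** ?R k) = antitranspose (?R k) ** ?c k"
      by (simp add: antitranspose_mult) (simp add: mat_eq_mat22)
    moreover have "?R (h \<otimes>\<^bsub>dihedral_group n\<^esub> ?inv k) = ?R h ** antitranspose (?R k)"
      using hk t by (simp add: dihedral_rep_mult dihedral_rep_inv)
    ultimately show "?u h ** ?c k ** ?R (h \<otimes>\<^bsub>dihedral_group n\<^esub> ?inv k)
        = (?u h ** ?R h) ** antitranspose (?c k ** ?R k)"
      by (metis scalar matrix_mul_assoc)
  qed
  also have "\<dots> = \<tau> n t u ** antitranspose (\<tau> n t c)"
    by (simp add: tau_eq_sum antitranspose_sum sum_matrix_mult matrix_mult_sum_right)
      (rule sum.swap)
  finally show ?thesis .
qed

text \<open>Multiplying by the indicator function of \<open>g\<close> translates by \<open>g\<close>, so a left ideal is closed under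
  translation and all coefficients of the correlation vanish; conversely the coefficient at the
  identity is the dot product itself.\<close>

lemma mem_dual_code_iff_correlation:
  assumes n: "n > 0" and code: "dihedral_code n I"
  shows "u \<in> dual_code n I \<longleftrightarrow>
    u \<in> carrier (dihedral_algebra n) \<and> (\<forall>c\<in>I. correlation n u c = (\<lambda>g. 0))"
proof -
  interpret G: group "dihedral_group n" using n by (rule group_dihedral_group)
  let ?G = "carrier (dihedral_group n)"
  have sub: "I \<subseteq> carrier (dihedral_algebra n)"
    using code additive_subgroup.a_subset by (auto simp: dihedral_code_def left_ideal_def)
  have translate_in: "translate n g c \<in> I" if c: "c \<in> I" and g: "g \<in> ?G" for c g
  proof -
    let ?d = "\<lambda>h. if h = g then 1 else 0 :: 'a"
    have "?d \<in> carrier (dihedral_algebra n)"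
      using g by (auto simp: group_algebra_def)
    then have "?d \<otimes>\<^bsub>dihedral_algebra n\<^esub> c \<in> I"
      using code c by (simp add: dihedral_code_def left_ideal_def)
    moreover have "?d \<otimes>\<^bsub>dihedral_algebra n\<^esub> c = translate n g c"
    proof
      fix h
      show "(?d \<otimes>\<^bsub>dihedral_algebra n\<^esub> c) h = translate n g c h"
        using g finite_dihedral_group[of n]
        by (simp add: group_algebra_def translate_def if_distrib[of "\<lambda>x. x * _"] cong: if_cong)
    qed
    ultimately show ?thesis by simp
  qed
  have translate_one: "translate n \<one>\<^bsub>dihedral_group n\<^esub> c = c" if "c \<in> I" for c
    using that sub by (auto simp: translate_def fun_eq_iff group_algebra_def)
  show ?thesis
  proof safe
    show "u \<in> carrier (dihedral_algebra n)" if "u \<in> dual_code n I"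
      using that by (simp add: dual_code_def)
    show "correlation n u c = (\<lambda>g. 0)" if "u \<in> dual_code n I" "c \<in> I" for c
      using that translate_in by (auto simp: dual_code_def correlation_def)
    assume u: "u \<in> carrier (dihedral_algebra n)" "\<forall>c\<in>I. correlation n u c = (\<lambda>g. 0)"
    have "dot_product n c u = 0" if c: "c \<in> I" for c
    proof -
      have "dot_product n c u = correlation n u c \<one>\<^bsub>dihedral_group n\<^esub>"
        by (simp add: correlation_def translate_one[OF c])
      then show ?thesis using u(2) c by simp
    qed
    then show "u \<in> dual_code n I" using u(1) by (simp add: dual_code_def)
  qed
qed


section \<open>Factorizations of \<open>x\<^sup>n - 1\<close> and interpolation\<close>

lemma of_nat_neq_0_if_coprime_CARD:
  assumes "coprime CARD('a::{field, finite}) n"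
  shows "(of_nat n :: 'a) \<noteq> 0"
proof
  assume "(of_nat n :: 'a) = 0"
  then have "CHAR('a) dvd n" by (simp add: of_nat_eq_0_iff_char_dvd)
  moreover have "CHAR('a) dvd CARD('a)" by (rule CHAR_dvd_CARD)
  ultimately have "CHAR('a) dvd 1" using assms by (meson coprime_common_divisor dvd_trans)
  then show False by simp
qed

lemma degree_monom_minus_1: "n > 0 \<Longrightarrow> degree (monom 1 n - 1 :: 'a::field poly) = n"
  using degree_add_eq_left[of "- 1" "monom 1 n :: 'a poly"] by (simp add: degree_monom_eq)

text \<open>The factors are arbitrary; that \<open>n\<close> is invertible makes all roots simple, and this is what
  separates the factors from each other.\<close>

locale split_root_of_unity_polynomial =
  fixes n :: nat and K :: "'i set" and g :: "'i \<Rightarrow> 'a::{field, finite} poly"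
    and \<beta> :: "'i \<Rightarrow> 'a alg_closure"
  assumes n_pos: "n > 0" and n_unit: "of_nat n \<noteq> (0 :: 'a)" and finite_K: "finite K"
    and prod_g: "monom 1 n - 1 = (\<Prod>k\<in>K. g k)"
    and root: "\<And>k. k \<in> K \<Longrightarrow> ev (g k) (\<beta> k) = 0"
begin

lemma root_power: "k \<in> K \<Longrightarrow> \<beta> k ^ n = 1"
proof -
  assume k: "k \<in> K"
  have "ev (monom 1 n - 1) (\<beta> k) = 0"
    unfolding prod_g ev_prod using k finite_K root by (intro prod_zero) auto
  then show ?thesis by simp
qed

text \<open>The roots of \<open>x\<^sup>n - 1\<close> are simple: if the cofactor \<open>h\<close> of \<open>g k\<close> also vanished at the root
  \<open>\<beta> k\<close>, so would the derivative of \<open>g k * h = x\<^sup>n - 1\<close>, which is \<open>n x\<^sup>n\<^sup>-\<^sup>1\<close>.\<close>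

lemma cofactor_neq_0:
  assumes k: "k \<in> K"
  shows "ev (\<Prod>l\<in>K - {k}. g l) (\<beta> k) \<noteq> 0"
proof
  define h where "h = (\<Prod>l\<in>K - {k}. g l)"
  assume "ev (\<Prod>l\<in>K - {k}. g l) (\<beta> k) = 0"
  then have h: "ev h (\<beta> k) = 0" by (simp add: h_def)
  have "monom 1 n - 1 = g k * h"
    unfolding prod_g h_def using finite_K k by (rule prod.remove)
  then have "pderiv (monom 1 n - 1) = g k * pderiv h + h * pderiv (g k)"
    by (simp add: pderiv_mult)
  then have "monom (of_nat n) (n - 1) = g k * pderiv h + h * pderiv (g k)"
    by (simp add: pderiv_diff pderiv_monom)
  then have "ev (monom (of_nat n) (n - 1)) (\<beta> k) = ev (g k * pderiv h + h * pderiv (g k)) (\<beta> k)"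
    by simp
  then have "of_nat n * \<beta> k ^ (n - 1) = 0"
    using root[OF k] h by simp
  moreover have "(of_nat n :: 'a alg_closure) \<noteq> 0"
    using n_unit by (metis to_ac_eq_0_iff to_ac_of_nat)
  moreover have "\<beta> k \<noteq> 0"
    using root_power[OF k] n_pos by (cases "\<beta> k = 0") (simp_all add: power_0_left)
  ultimately show False by simp
qed

lemma partial_prod_neq_0:
  assumes "k \<in> K" "L \<subseteq> K - {k}"
  shows "ev (\<Prod>l\<in>L. g l) (\<beta> k) \<noteq> 0"
proof -
  have "(\<Prod>l\<in>K - {k}. g l) = (\<Prod>l\<in>(K - {k}) - L. g l) * (\<Prod>l\<in>L. g l)"
    using finite_K assms(2) by (intro prod.subset_diff) auto
  then show ?thesis using cofactor_neq_0[OF assms(1)] by auto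
qed

lemma no_common_roots: "k \<in> K \<Longrightarrow> l \<in> K \<Longrightarrow> k \<noteq> l \<Longrightarrow> ev (g l) (\<beta> k) \<noteq> 0"
  using partial_prod_neq_0[of k "{l}"] by simp

text \<open>The Chinese remainder theorem in terms of values. The cofactor of \<open>g k\<close> vanishes at the roots
  chosen for the other factors and not at \<open>\<beta> k\<close>; because \<open>adjoin (\<beta> k)\<close> is a field, a multiple of it
  has the value \<open>1\<close> there.\<close>

lemma interpolation:
  obtains P where "degree P < n" "\<And>k. k \<in> K \<Longrightarrow> ev P (\<beta> k) = ev (p k) (\<beta> k)"
proof -
  \<comment> \<open>\<open>w k\<close> inverts the cofactor of \<open>g k\<close> at \<open>\<beta> k\<close>.\<close>
  have "\<exists>w. \<forall>k\<in>K. ev (w k * (\<Prod>l\<in>K - {k}. g l)) (\<beta> k) = 1"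
  proof (intro bchoice ballI)
    fix k assume k: "k \<in> K"
    let ?h = "ev (\<Prod>l\<in>K - {k}. g l) (\<beta> k)"
    have "subfield_of (adjoin (\<beta> k))"
      using finite_adjoin_root_of_unity[OF root_power[OF k] n_pos] by (rule subfield_of_adjoin)
    then have "inverse ?h \<in> adjoin (\<beta> k)" by (rule subfield_ofD(5)) (rule adjoinI)
    then obtain w where "inverse ?h = ev w (\<beta> k)" by (auto simp: adjoin_def)
    then show "\<exists>w. ev (w * (\<Prod>l\<in>K - {k}. g l)) (\<beta> k) = 1"
      using cofactor_neq_0[OF k] by (intro exI[of _ w]) (simp add: field_simps)
  qed
  then obtain w where w: "\<And>k. k \<in> K \<Longrightarrow> ev (w k * (\<Prod>l\<in>K - {k}. g l)) (\<beta> k) = 1"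
    by auto
  define e where "e k = w k * (\<Prod>l\<in>K - {k}. g l)" for k
  have e: "ev (e l) (\<beta> k) = (if l = k then 1 else 0)" if "k \<in> K" "l \<in> K" for k l
  proof (cases "l = k")
    case True
    then show ?thesis using w that by (simp add: e_def)
  next
    case False
    then have "ev (\<Prod>l\<in>K - {l}. g l) (\<beta> k) = 0"
      unfolding ev_prod using that finite_K root by (intro prod_zero) auto
    then show ?thesis using False by (simp add: e_def)
  qed
  define S where "S = (\<Sum>l\<in>K. p l * e l)"
  define U where "U = (monom 1 n - 1 :: 'a poly)"
  have S: "ev S (\<beta> k) = ev (p k) (\<beta> k)" if "k \<in> K" for k
  proof -
    have "ev S (\<beta> k) = (\<Sum>l\<in>K. if l = k then ev (p k) (\<beta> k) else 0)"
      unfolding S_def ev_sum using e that by (intro sum.cong) auto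
    then show ?thesis using that finite_K by simp
  qed
  have deg: "degree U = n" unfolding U_def by (rule degree_monom_minus_1[OF n_pos])
  show ?thesis
  proof (rule that)
    show "degree (S mod U) < n"
    proof -
      have "U \<noteq> 0" using deg n_pos by auto
      then show ?thesis using degree_mod_less[of U S] deg n_pos by auto
    qed
    fix k assume k: "k \<in> K"
    have "ev (S mod U) (\<beta> k) = ev S (\<beta> k) - ev (S div U) (\<beta> k) * ev U (\<beta> k)"
      by (simp flip: ev_mult ev_diff add: minus_div_mult_eq_mod)
    also have "ev U (\<beta> k) = 0" using root_power[OF k] by (simp add: U_def)
    finally show "ev (S mod U) (\<beta> k) = ev (p k) (\<beta> k)" using S[OF k] by simp
  qed
qed

text \<open>The factors divide \<open>P\<close> one after the other: the product of those already split off does not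
  vanish at the next root, so the remaining quotient does.\<close>

lemma eq_0_if_vanishes_at_roots:
  assumes irred: "\<And>k. k \<in> K \<Longrightarrow> irreducible (g k)"
    and deg: "degree P < n" and zero: "\<And>k. k \<in> K \<Longrightarrow> ev P (\<beta> k) = 0"
  shows "P = 0"
proof -
  have "(\<Prod>l\<in>L. g l) dvd P" if "finite L" "L \<subseteq> K" for L
    using that
  proof (induction L)
    case (insert k L)
    then obtain R where R: "P = (\<Prod>l\<in>L. g l) * R" by (auto elim: dvdE)
    have "ev (\<Prod>l\<in>L. g l) (\<beta> k) \<noteq> 0"
      using insert by (intro partial_prod_neq_0) auto
    then have "ev R (\<beta> k) = 0"
      using zero[of k] insert.prems R by auto
    then have "g k dvd R"
      using insert.prems irred root by (intro irreducible_dvd_if_common_root[of _ "\<beta> k"]) auto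
    then show ?case using insert R by (simp add: mult.commute[of "g k"] mult_dvd_mono)
  qed simp
  from this[OF finite_K] have "(monom 1 n - 1) dvd P" by (simp add: prod_g)
  then show ?thesis
    using deg degree_monom_minus_1[OF n_pos, where 'a = 'a] by (metis dvd_imp_degree_le leD)
qed

end


section \<open>Matrices over a subfield and their orthogonal complements\<close>

definition mat_over :: "'k set \<Rightarrow> ('k^2^2) set" where
  "mat_over F = {M. \<forall>i k. vec_nth (vec_nth M i) k \<in> F}"

lemma mat22_in_mat_over_iff [simp]:
  "mat22 p q s t \<in> mat_over F \<longleftrightarrow> p \<in> F \<and> q \<in> F \<and> s \<in> F \<and> t \<in> F"
  by (auto simp: mat_over_def forall_2)

lemma mat_over_mult:
  assumes "subfield_of F" "M \<in> mat_over F" "N \<in> mat_over F"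
  shows "M ** N \<in> mat_over F"
  using assms(2,3) subfield_ofD[OF assms(1)]
  by (cases M rule: mat22_cases; cases N rule: mat22_cases) (simp add: mat22_mult)

lemma mat_over_sum:
  assumes "subfield_of F" "\<And>i. i \<in> A \<Longrightarrow> M i \<in> mat_over F"
  shows "(\<Sum>i\<in>A. M i) \<in> mat_over F"
  using assms by (simp add: mat_over_def sum_nth_nth sum_in_subfield_of)

definition row_ideal :: "'k::field set \<Rightarrow> 'k \<Rightarrow> 'k \<Rightarrow> ('k^2^2) set" where
  "row_ideal F x y = {mat22 (k * y) (- k * x) (t * y) (- t * x) | k t. k \<in> F \<and> t \<in> F}"

text \<open>A line in \<open>F\<^sup>2\<close> described by a spanning vector and by its equation.\<close>

lemma row_multiple_iff:
  assumes F: "subfield_of F" "x \<in> F" "y \<in> F" and nz: "x \<noteq> 0 \<or> y \<noteq> 0"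
  shows "(\<exists>k\<in>F. a = k * y \<and> b = - k * x) \<longleftrightarrow> a \<in> F \<and> b \<in> F \<and> a * x + b * y = 0"
proof
  assume "\<exists>k\<in>F. a = k * y \<and> b = - k * x"
  then show "a \<in> F \<and> b \<in> F \<and> a * x + b * y = 0"
    using F subfield_ofD[OF F(1)] by (auto simp: algebra_simps)
next
  assume ab: "a \<in> F \<and> b \<in> F \<and> a * x + b * y = 0"
  show "\<exists>k\<in>F. a = k * y \<and> b = - k * x"
  proof (cases "y = 0")
    case True
    then show ?thesis
      using ab nz F subfield_ofD[OF F(1)] by (intro bexI[of _ "- b / x"]) auto
  next
    case False
    then have "b = - (a * x) / y" using ab by (simp add: field_simps eq_neg_iff_add_eq_0)
    then show ?thesis
      using False ab F subfield_ofD[OF F(1)] by (intro bexI[of _ "a / y"]) auto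
  qed
qed

lemma mat22_in_row_ideal_iff:
  assumes "subfield_of F" "x \<in> F" "y \<in> F" "x \<noteq> 0 \<or> y \<noteq> 0"
  shows "mat22 a b c d \<in> row_ideal F x y \<longleftrightarrow>
    mat22 a b c d \<in> mat_over F \<and> a * x + b * y = 0 \<and> c * x + d * y = 0"
proof -
  have "mat22 a b c d \<in> row_ideal F x y \<longleftrightarrow>
      (\<exists>k\<in>F. a = k * y \<and> b = - k * x) \<and> (\<exists>t\<in>F. c = t * y \<and> d = - t * x)"
    unfolding row_ideal_def by auto
  then show ?thesis unfolding row_multiple_iff[OF assms] by auto
qed

lemma row_ideal_scale:
  assumes "subfield_of F" "x \<in> F" "y \<in> F" "x \<noteq> 0 \<or> y \<noteq> 0" "u \<in> F" "u \<noteq> 0"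
  shows "row_ideal F (u * x) (u * y) = row_ideal F x y"
proof -
  have factor: "a * (u * x) + b * (u * y) = u * (a * x + b * y)" for a b
    by (simp add: algebra_simps)
  have "M \<in> row_ideal F (u * x) (u * y) \<longleftrightarrow> M \<in> row_ideal F x y" for M
    by (cases M rule: mat22_cases)
      (use assms subfield_ofD(4)[OF assms(1)] in \<open>simp add: mat22_in_row_ideal_iff factor\<close>)
  then show ?thesis by blast
qed

text \<open>The left annihilator of the antitransposes of \<open>B\<close>, with a symmetric matrix inserted that the
  change of basis \<open>\<sigma>\<close> produces. The parameters \<open>c = 1\<close>, \<open>d = 0\<close> give the annihilator without
  change of basis.\<close>

definition mat_perp :: "'k::field set \<Rightarrow> 'k \<Rightarrow> 'k \<Rightarrow> ('k^2^2) set \<Rightarrow> ('k^2^2) set" where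
  "mat_perp F c d B = {M \<in> mat_over F. \<forall>N\<in>B. M ** mat22 c d d c ** antitranspose N = 0}"

lemma mat_perp_zero: "mat_perp F c d {0} = mat_over F"
  by (simp add: mat_perp_def)

text \<open>Testing with the identity matrix suffices, since the inserted matrix has determinant
  \<open>c\<^sup>2 - d\<^sup>2 \<noteq> 0\<close>.\<close>

lemma mat_perp_full:
  fixes F :: "'a::field set"
  assumes "subfield_of F" "c\<^sup>2 \<noteq> d\<^sup>2"
  shows "mat_perp F c d (mat_over F) = {0}"
proof -
  have "M = 0" if M: "M \<in> mat_perp F c d (mat_over F)" for M
  proof -
    have "mat 1 \<in> mat_over F" using subfield_ofD[OF assms(1)] by (simp add: mat_eq_mat22)
    then have "M ** mat22 c d d c ** antitranspose (mat 1) = 0"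
      using M by (auto simp: mat_perp_def)
    moreover have "antitranspose (mat 1) = (mat 1 :: 'a^2^2)" by (simp add: mat_eq_mat22)
    ultimately have "M ** (mat22 c d d c ** mat22 c (- d) (- d) c) = 0"
      by (simp add: matrix_mul_assoc)
    moreover have "mat22 c d d c ** mat22 c (- d) (- d) c = mat (c\<^sup>2 - d\<^sup>2)"
      by (simp add: mat22_mult mat_eq_mat22 power2_eq_square)
    ultimately have "M ** mat (c\<^sup>2 - d\<^sup>2) = 0" by simp
    then show "M = 0"
      using assms(2) by (cases M rule: mat22_cases) (simp add: mat22_mult mat_eq_mat22 zero_eq_mat22)
  qed
  moreover have "0 \<in> mat_perp F c d (mat_over F)"
    using subfield_ofD(2)[OF assms(1)]
    by (simp add: mat_perp_def) (simp add: zero_eq_mat22)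
  ultimately show ?thesis by blast
qed

text \<open>A row \<open>(a, b)\<close> of the annihilator has to satisfy the single linear equation
  \<open>(a c + b d) x = (a d + b c) y\<close>, whose solutions form the line spanned by
  \<open>(c y - d x, c x - d y)\<close>; the equation is nontrivial because \<open>c\<^sup>2 \<noteq> d\<^sup>2\<close> and
  \<open>(x, y) \<noteq> (0, 0)\<close>.\<close>

lemma mat_perp_row_ideal:
  assumes F: "subfield_of F" "c \<in> F" "d \<in> F" "x \<in> F" "y \<in> F"
    and nz: "c\<^sup>2 \<noteq> d\<^sup>2" "x \<noteq> 0 \<or> y \<noteq> 0"
  shows "mat_perp F c d (row_ideal F x y) = row_ideal F (d * y - c * x) (c * y - d * x)"
proof -
  have "d * y - c * x \<noteq> 0 \<or> c * y - d * x \<noteq> 0"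
  proof (rule ccontr)
    assume "\<not> ?thesis"
    then have eq: "d * y = c * x" "c * y = d * x" by auto
    have "c * (c * x) = d * (d * x)" "c * (c * y) = d * (d * y)"
      by (metis eq mult.left_commute)+
    then have "(c\<^sup>2 - d\<^sup>2) * x = 0" "(c\<^sup>2 - d\<^sup>2) * y = 0"
      by (simp_all add: power2_eq_square algebra_simps)
    then show False using nz by auto
  qed
  moreover have "d * y - c * x \<in> F" "c * y - d * x \<in> F"
    using F subfield_ofD[OF F(1)] by auto
  ultimately have iff: "mat22 a b e f \<in> row_ideal F (d * y - c * x) (c * y - d * x) \<longleftrightarrow>
      mat22 a b e f \<in> mat_over F \<and> a * (d * y - c * x) + b * (c * y - d * x) = 0
        \<and> e * (d * y - c * x) + f * (c * y - d * x) = 0" for a b e f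
    using F(1) by (intro mat22_in_row_ideal_iff)
  have product: "mat22 a b e f ** mat22 c d d c ** antitranspose (mat22 (k * y) (- k * x) (t * y) (- t * x))
      = mat22 (t * (a * (d * y - c * x) + b * (c * y - d * x)))
              (k * (a * (d * y - c * x) + b * (c * y - d * x)))
              (t * (e * (d * y - c * x) + f * (c * y - d * x)))
              (k * (e * (d * y - c * x) + f * (c * y - d * x)))" for a b e f k t
    by (simp add: mat22_mult algebra_simps)
  have all_multiples_zero: "(\<forall>k\<in>F. \<forall>t\<in>F. t * p = 0 \<and> k * p = 0 \<and> t * q = 0 \<and> k * q = 0)
      \<longleftrightarrow> p = 0 \<and> q = 0" for p q
    using subfield_ofD(1)[OF F(1)] mult_1 mult_zero_right by metis
  have "M \<in> mat_perp F c d (row_ideal F x y) \<longleftrightarrow>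
      M \<in> row_ideal F (d * y - c * x) (c * y - d * x)" for M
  proof (cases M rule: mat22_cases)
    case (1 a b e f)
    have "M \<in> mat_perp F c d (row_ideal F x y) \<longleftrightarrow> M \<in> mat_over F \<and>
        (\<forall>k\<in>F. \<forall>t\<in>F. M ** mat22 c d d c
           ** antitranspose (mat22 (k * y) (- k * x) (t * y) (- t * x)) = 0)"
      unfolding mat_perp_def row_ideal_def by blast
    also have "\<dots> \<longleftrightarrow> mat22 a b e f \<in> mat_over F \<and> a * (d * y - c * x) + b * (c * y - d * x) = 0
        \<and> e * (d * y - c * x) + f * (c * y - d * x) = 0"
      unfolding 1 product zero_eq_mat22 mat22_eq_iff using all_multiples_zero by simp
    finally show ?thesis unfolding iff[symmetric] 1 .
  qed
  then show ?thesis by blast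
qed


section \<open>The change of basis in the self-reciprocal components\<close>

locale reciprocal_pair =
  fixes t t' :: "'a::field alg_closure"
  assumes t_neq_0: "t \<noteq> 0" and t'_eq: "t' = inverse t" and t_neq_t': "t \<noteq> t'"
begin

definition "Z = mat22 1 (- t) 1 (- t')"

definition "W = mat22 (- t' / (t - t')) (t / (t - t')) (- 1 / (t - t')) (1 / (t - t'))"

lemma t_mult_t': "t * t' = 1" "t' * t = 1"
  using t_neq_0 by (simp_all add: t'_eq)

lemma Z_W: "Z ** W = mat 1" and W_Z: "W ** Z = mat 1"
  using t_neq_t' by (simp_all add: Z_def W_def mat22_mult mat_eq_mat22 divide_simps)

lemma sigma_eq: "\<sigma> t M = W ** M ** Z"
proof -
  have "Z ** matrix_inv Z = mat 1"
    unfolding matrix_inv_def by (rule someI2[of _ W]) (simp_all add: Z_W W_Z)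
  then have "matrix_inv Z = W"
    by (metis W_Z matrix_mul_assoc matrix_mul_lid matrix_mul_rid)
  then show ?thesis unfolding \<sigma>_def Let_def t'_eq[symmetric] Z_def[symmetric] by simp
qed

lemma sigma_mult: "\<sigma> t (M ** N) = \<sigma> t M ** \<sigma> t N"
proof -
  have "\<sigma> t M ** \<sigma> t N = W ** M ** (Z ** W) ** N ** Z"
    by (simp add: sigma_eq matrix_mul_assoc)
  then show ?thesis by (simp add: Z_W sigma_eq matrix_mul_assoc)
qed

lemma sigma_scalar: "\<sigma> t (mat k) = mat k"
proof -
  have "mat k ** M = M ** mat k" for M :: "'a alg_closure^2^2"
    by (cases M rule: mat22_cases) (simp add: mat_eq_mat22 mat22_mult)
  then have "\<sigma> t (mat k) = mat k ** (W ** Z)" by (simp add: sigma_eq matrix_mul_assoc)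
  then show ?thesis by (simp add: W_Z)
qed

lemma sigma_sum: "\<sigma> t (\<Sum>x\<in>A. M x) = (\<Sum>x\<in>A. \<sigma> t (M x))"
  by (simp add: sigma_eq sum_matrix_mult matrix_mult_sum_right)

lemma sigma_conjugate: "\<sigma> t (Z ** M ** W) = M"
proof -
  have "\<sigma> t (Z ** M ** W) = (W ** Z) ** M ** (W ** Z)" by (simp add: sigma_eq matrix_mul_assoc)
  then show ?thesis by (simp add: W_Z)
qed

text \<open>In the new basis the generators \<open>a\<close> and \<open>b\<close> have entries in the field generated by
  \<open>t + t\<^sup>-\<^sup>1\<close>. Hence so does every element of the group algebra, which is the purpose of the
  conjugation \<open>\<sigma>\<close>.\<close>

lemma sigma_rotation: "\<sigma> t (dihedral_rep t (False, 1)) = mat22 0 1 (- 1) (t + t')"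
proof -
  have "dihedral_rep t (False, 1) ** Z = Z ** mat22 0 1 (- 1) (t + t')"
    by (simp add: dihedral_rep_def Z_def mat22_mult t'_eq[symmetric] algebra_simps t_mult_t')
  then have "\<sigma> t (dihedral_rep t (False, 1)) = (W ** Z) ** mat22 0 1 (- 1) (t + t')"
    by (simp add: sigma_eq flip: matrix_mul_assoc)
  then show ?thesis by (simp add: W_Z)
qed

lemma sigma_reflection: "\<sigma> t (dihedral_rep t (True, 0)) = mat22 1 (- (t + t')) 0 (- 1)"
proof -
  have "dihedral_rep t (True, 0) ** Z = Z ** mat22 1 (- (t + t')) 0 (- 1)"
    by (simp add: dihedral_rep_def Z_def mat22_mult algebra_simps)
  then have "\<sigma> t (dihedral_rep t (True, 0)) = (W ** Z) ** mat22 1 (- (t + t')) 0 (- 1)"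
    by (simp add: sigma_eq flip: matrix_mul_assoc)
  then show ?thesis by (simp add: W_Z)
qed

lemma sigma_tau_in_mat_over:
  assumes F: "subfield_of (adjoin (t + t'))"
  shows "\<sigma> t (\<tau> n t u) \<in> mat_over (adjoin (t + t'))"
proof -
  note F' = subfield_ofD[OF F] generator_in_adjoin
  have rot: "\<sigma> t (dihedral_rep t (False, i)) \<in> mat_over (adjoin (t + t'))" for i
  proof (induction i)
    case 0
    have "dihedral_rep t (False, 0) = mat 1" by (simp add: dihedral_rep_def mat_eq_mat22)
    then have "\<sigma> t (dihedral_rep t (False, 0)) = mat 1" by (simp only: sigma_scalar)
    then show ?case using F' by (simp add: mat_eq_mat22)
  next
    case (Suc i)
    have "dihedral_rep t (False, Suc i) = dihedral_rep t (False, i) ** dihedral_rep t (False, 1)"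
      by (simp add: dihedral_rep_def mat22_mult)
    then have "\<sigma> t (dihedral_rep t (False, Suc i))
        = \<sigma> t (dihedral_rep t (False, i)) ** mat22 0 1 (- 1) (t + t')"
      by (simp only: sigma_mult sigma_rotation)
    then show ?case using Suc F' by (auto intro!: mat_over_mult[OF F])
  qed
  have "\<sigma> t (dihedral_rep t (e, i)) \<in> mat_over (adjoin (t + t'))" for e i
  proof (cases e)
    case True
    have "dihedral_rep t (e, i) = dihedral_rep t (True, 0) ** dihedral_rep t (False, i)"
      using True by (simp add: dihedral_rep_def mat22_mult)
    then have "\<sigma> t (dihedral_rep t (e, i))
        = mat22 1 (- (t + t')) 0 (- 1) ** \<sigma> t (dihedral_rep t (False, i))"
      by (simp only: sigma_mult sigma_reflection)
    moreover have "mat22 1 (- (t + t')) 0 (- 1) \<in> mat_over (adjoin (t + t'))"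
      by (simp add: F'(1,2) F'(6)[OF F'(1)] F'(6)[OF generator_in_adjoin] del: minus_add_distrib)
    ultimately show ?thesis using rot F by (simp add: mat_over_mult)
  next
    case False
    then show ?thesis using rot by simp
  qed
  moreover have "mat (to_ac b) \<in> mat_over (adjoin (t + t'))" for b
    by (simp add: mat_eq_mat22 F'(2) to_ac_in_adjoin)
  ultimately show ?thesis
    unfolding tau_eq_sum sigma_sum sigma_mult sigma_scalar
    by (intro mat_over_sum[OF F] mat_over_mult[OF F]) auto
qed

text \<open>The antitranspose does not commute with conjugation by \<open>Z\<close>. The defect is
  \<open>W ** antitranspose W\<close>, and the matrix with entries \<open>t + t\<^sup>-\<^sup>1\<close> and \<open>2\<close> is proportional to it: the
  sandwich with \<open>Z\<close> and its antitranspose is the scalar \<open>- (t - t\<^sup>-\<^sup>1)\<^sup>2\<close>.\<close>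

lemma product_eq_0_iff_sigma:
  "M ** antitranspose N = 0 \<longleftrightarrow>
     \<sigma> t M ** mat22 (t + t') 2 2 (t + t') ** antitranspose (\<sigma> t N) = 0"
proof -
  define \<delta> where "\<delta> = - (t - t')\<^sup>2"
  have \<delta>: "\<delta> \<noteq> 0" using t_neq_t' by (simp add: \<delta>_def)
  have gram: "Z ** mat22 (t + t') 2 2 (t + t') ** antitranspose Z = mat \<delta>"
    by (simp add: Z_def mat22_mult mat_eq_mat22 \<delta>_def power2_eq_square algebra_simps t_mult_t')
  have "\<sigma> t M ** mat22 (t + t') 2 2 (t + t') ** antitranspose (\<sigma> t N)
      = W ** M ** (Z ** mat22 (t + t') 2 2 (t + t') ** antitranspose Z)
          ** antitranspose N ** antitranspose W"
    by (simp add: sigma_eq antitranspose_mult matrix_mul_assoc)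
  also have "\<dots> = mat \<delta> ** (W ** (M ** antitranspose N) ** antitranspose W)"
  proof -
    have "M ** mat \<delta> = mat \<delta> ** M" for M :: "'a alg_closure^2^2"
      by (cases M rule: mat22_cases) (simp add: mat_eq_mat22 mat22_mult)
    then show ?thesis by (simp add: gram matrix_mul_assoc)
  qed
  finally have eq: "\<sigma> t M ** mat22 (t + t') 2 2 (t + t') ** antitranspose (\<sigma> t N)
      = mat \<delta> ** (W ** (M ** antitranspose N) ** antitranspose W)" .
  have cancel: "mat \<delta> ** M = 0 \<longleftrightarrow> M = 0" for M :: "'a alg_closure^2^2"
    using \<delta> by (cases M rule: mat22_cases) (simp add: mat_eq_mat22 mat22_mult zero_eq_mat22)
  have "Z ** (W ** M ** antitranspose W) ** antitranspose Z = M" for M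
  proof -
    have "antitranspose W ** antitranspose Z = mat 1"
      by (simp add: Z_W flip: antitranspose_mult) (simp add: mat_eq_mat22)
    moreover have "Z ** (W ** M ** antitranspose W) ** antitranspose Z
        = (Z ** W) ** M ** (antitranspose W ** antitranspose Z)"
      by (simp add: matrix_mul_assoc)
    ultimately show ?thesis by (simp add: Z_W)
  qed
  then have "W ** M ** antitranspose W = 0 \<longleftrightarrow> M = 0" for M
    by (metis matrix_mult_zero)
  then show ?thesis unfolding eq cancel by simp
qed

text \<open>The converse of \<open>sigma_tau_in_mat_over\<close> for a root \<open>t\<close> whose polynomial relations also hold
  for \<open>t\<^sup>-\<^sup>1\<close>. Exchanging \<open>t\<close> and \<open>t\<^sup>-\<^sup>1\<close> fixes the entries of \<open>A\<close> and exchanges the rows of \<open>Z\<close>, hence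
  also the columns of its inverse. So it carries each entry of \<open>Z A Z\<^sup>-\<^sup>1\<close> to the opposite one, which
  is the shape of a value of \<open>\<tau>\<close>.\<close>

lemma rational_matrix_is_sigma_image:
  assumes A: "A \<in> mat_over (adjoin (t + t'))" and F: "subfield_of (adjoin t)"
    and transfer: "\<And>p q. ev p t = ev q t \<Longrightarrow> ev p t' = ev q t'"
    and v: "ev v t = t'" "ev v t' = t"
  obtains p q where "Z ** A ** W = mat22 (ev p t) (ev q t') (ev q t) (ev p t')"
proof -
  \<comment> \<open>Below, \<open>w\<close> represents the reciprocal of the determinant of \<open>Z\<close>, which changes sign when
    \<open>t\<close> and \<open>t\<^sup>-\<^sup>1\<close> are exchanged.\<close>
  define x :: "'a poly" where "x = [:0, 1:]"
  have x: "ev x s = s" for s by (simp add: x_def ev_pCons)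
  have "inverse (ev (x - v) t) \<in> adjoin t" by (rule subfield_ofD(5)[OF F adjoinI])
  then obtain w where "inverse (ev (x - v) t) = ev w t" by (auto simp: adjoin_def)
  define d where "d = inverse (t - t')"
  have w: "ev w t = d" using \<open>inverse (ev (x - v) t) = ev w t\<close> by (simp add: x v d_def)
  have W: "W = mat22 (- t' * d) (t * d) (- d) d" by (simp add: W_def d_def divide_inverse)
  then have "ev (w * (x - v)) t = ev 1 t" using t_neq_t' by (simp add: x v w d_def)
  from transfer[OF this] have "ev w t' * (t' - t) = 1" by (simp add: x v)
  then have "(t - t') * (- ev w t') = 1" by (simp add: algebra_simps)
  then have w': "ev w t' = - d" unfolding d_def by (metis inverse_unique minus_minus)
  have lift: "\<exists>b. ev b t = a \<and> ev b t' = a" if "a \<in> adjoin (t + t')" for a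
  proof -
    obtain b where "a = ev b (t + t')" using \<open>a \<in> _\<close> by (auto simp: adjoin_def)
    then show ?thesis
      by (intro exI[of _ "pcompose b (x + v)"]) (simp add: ev_pcompose x v add.commute)
  qed
  obtain a1 a2 a3 a4 where A_eq: "A = mat22 a1 a2 a3 a4" by (rule mat22_cases)
  then have A_in: "a1 \<in> adjoin (t + t')" "a2 \<in> adjoin (t + t')" "a3 \<in> adjoin (t + t')"
    "a4 \<in> adjoin (t + t')"
    using A by simp_all
  obtain b1 where b1: "ev b1 t = a1" "ev b1 t' = a1" using lift[OF A_in(1)] by blast
  obtain b2 where b2: "ev b2 t = a2" "ev b2 t' = a2" using lift[OF A_in(2)] by blast
  obtain b3 where b3: "ev b3 t = a3" "ev b3 t' = a3" using lift[OF A_in(3)] by blast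
  obtain b4 where b4: "ev b4 t = a4" "ev b4 t' = a4" using lift[OF A_in(4)] by blast
  show ?thesis
    by (rule that[of "w * (- v * (b1 - x * b3) - (b2 - x * b4))"
          "w * (- v * (b1 - v * b3) - (b2 - v * b4))"])
      (simp add: A_eq Z_def W mat22_mult b1 b2 b3 b4 v w w' x, simp add: algebra_simps)
qed

end


section \<open>Components and their orthogonal complements\<close>

lemma subfield_of_range_to_ac: "subfield_of (range to_ac)"
  unfolding subfield_of_def
  by (auto simp flip: to_ac_diff to_ac_mult to_ac_inverse to_ac_1)

lemma c2_elem_nth [simp]: "c2_elem p q 0 = p" "c2_elem p q 1 = q"
  by (simp_all add: c2_elem_def)

lemma c2_elem_eq_iff [simp]: "c2_elem p q = c2_elem p' q' \<longleftrightarrow> p = p' \<and> q = q'"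
  by (metis c2_elem_nth)

lemma carrier_c2_algebra:
  fixes F :: "'k::comm_ring_1 set"
  shows "carrier (group_algebra F (integer_mod_group 2)) = {c2_elem p q | p q. p \<in> F \<and> q \<in> F}"
proof -
  have two: "{0..<2} = {0, 1 :: int}" by auto
  have "u = c2_elem (u 0) (u 1)" if "\<forall>g. g \<notin> {0, 1 :: int} \<longrightarrow> u g = 0" for u :: "int \<Rightarrow> 'k"
    using that by (auto simp: c2_elem_def fun_eq_iff)
  then show ?thesis
    unfolding group_algebra_def carrier_integer_mod_group
    by (auto simp: two c2_elem_def)
qed

lemma c2_mult:
  "c2_elem p q \<otimes>\<^bsub>group_algebra F (integer_mod_group 2)\<^esub> c2_elem p' q'
   = c2_elem (p * p' + q * q') (p * q' + q * p')"
proof -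
  have two: "carrier (integer_mod_group 2) = {0, 1 :: int}"
    by (auto simp: carrier_integer_mod_group)
  have inv: "inv\<^bsub>integer_mod_group 2\<^esub> 0 = (0 :: int)" "inv\<^bsub>integer_mod_group 2\<^esub> 1 = (1 :: int)"
    by (simp_all add: carrier_integer_mod_group)
  show ?thesis
    by (auto simp: group_algebra_def two inv c2_elem_def fun_eq_iff)
qed

lemma c2_ideals:
  fixes F :: "'k::field set"
  assumes F: "subfield_of F"
  shows "PIdl\<^bsub>group_algebra F (integer_mod_group 2)\<^esub> (c2_elem 1 1) = {c2_elem k k | k. k \<in> F}"
    and "PIdl\<^bsub>group_algebra F (integer_mod_group 2)\<^esub> (c2_elem 1 (- 1)) = {c2_elem k (- k) | k. k \<in> F}"
proof -
  have ideal: "PIdl\<^bsub>group_algebra F (integer_mod_group 2)\<^esub> (c2_elem x y)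
      = {c2_elem (p * x + q * y) (p * y + q * x) | p q. p \<in> F \<and> q \<in> F}" for x y
    unfolding cgenideal_def carrier_c2_algebra c2_mult[where F = F, symmetric] by blast
  show "PIdl\<^bsub>group_algebra F (integer_mod_group 2)\<^esub> (c2_elem 1 1) = {c2_elem k k | k. k \<in> F}"
    unfolding ideal
  proof safe
    fix k assume "k \<in> F"
    then show "\<exists>p q. c2_elem k k = c2_elem (p * 1 + q * 1) (p * 1 + q * 1) \<and> p \<in> F \<and> q \<in> F"
      using subfield_ofD(2)[OF F] by (intro exI[of _ k] exI[of _ 0]) simp
  qed (use subfield_ofD(7)[OF F] in auto)
  show "PIdl\<^bsub>group_algebra F (integer_mod_group 2)\<^esub> (c2_elem 1 (- 1))
      = {c2_elem k (- k) | k. k \<in> F}"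
    unfolding ideal
  proof safe
    fix k assume "k \<in> F"
    then show "\<exists>p q. c2_elem k (- k) = c2_elem (p * 1 + q * - 1) (p * - 1 + q * 1) \<and> p \<in> F \<and> q \<in> F"
      using subfield_ofD(2)[OF F] by (intro exI[of _ k] exI[of _ 0]) simp
  qed (use subfield_ofD(3)[OF F] in auto)
qed

text \<open>The condition that \<open>\<tau> u\<close> times the antitranspose of \<open>\<tau> c\<close> vanishes, written in terms of the
  components \<open>a\<close> of \<open>u\<close> and \<open>b\<close> of \<open>c\<close> (see \<open>summand_orthogonal_proj_iff\<close>). For \<open>j \<le> \<zeta> n\<close> it says
  that the product of \<open>a\<close> and \<open>b\<close> in the group algebra of \<open>{1, h}\<close> is zero.\<close>

definition summand_orthogonal ::
    "nat \<Rightarrow> nat \<Rightarrow> (nat \<Rightarrow> 'a::field alg_closure) \<Rightarrow> nat \<Rightarrow> 'a alg_closure summand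
       \<Rightarrow> 'a alg_closure summand \<Rightarrow> bool" where
  "summand_orthogonal n r \<alpha> j a b =
     (if j \<le> \<zeta> n then
        projl a 0 * projl b 0 + projl a 1 * projl b 1 = 0
          \<and> projl a 0 * projl b 1 + projl a 1 * projl b 0 = 0
      else if j \<le> r then
        projr a ** mat22 (\<alpha> j + inverse (\<alpha> j)) 2 2 (\<alpha> j + inverse (\<alpha> j)) ** antitranspose (projr b) = 0
      else projr a ** mat22 1 0 0 1 ** antitranspose (projr b) = 0)"

definition summand_perp ::
    "nat \<Rightarrow> nat \<Rightarrow> (nat \<Rightarrow> 'a::field alg_closure) \<Rightarrow> nat \<Rightarrow> 'a alg_closure summand set
       \<Rightarrow> 'a alg_closure summand set" where
  "summand_perp n r \<alpha> j B =
     {a \<in> summand_algebra n r \<alpha> j. \<forall>b\<in>B. summand_orthogonal n r \<alpha> j a b}"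

text \<open>The annihilator of the multiples of \<open>1 + h\<close> is given by \<open>p + q = 0\<close> and that of the multiples of
  \<open>1 - h\<close> by \<open>p = q\<close>, also in characteristic two.\<close>

lemma summand_perp_c2:
  fixes \<alpha> :: "nat \<Rightarrow> 'a::field alg_closure"
  assumes j: "j \<le> \<zeta> n"
  shows "summand_perp n r \<alpha> j (summand_zero n j) = summand_algebra n r \<alpha> j"
    and "summand_perp n r \<alpha> j (summand_algebra n r \<alpha> j) = summand_zero n j"
    and "summand_perp n r \<alpha> j (summand_ideal n r \<alpha> j 1 0) = summand_ideal n r \<alpha> j 0 1"
    and "summand_perp n r \<alpha> j (summand_ideal n r \<alpha> j 0 1) = summand_ideal n r \<alpha> j 1 0"
proof -
  define F where "F = (range to_ac :: 'a alg_closure set)"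
  have subfield: "subfield_of F" unfolding F_def by (rule subfield_of_range_to_ac)
  note F' = subfield_ofD[OF subfield]
  have neg_in_F: "- p \<in> F \<longleftrightarrow> p \<in> F" for p using F'(6) by (metis minus_minus)
  have algebra: "summand_algebra n r \<alpha> j = Inl ` {c2_elem p q | p q. p \<in> F \<and> q \<in> F}"
    using j by (simp add: summand_algebra_def coeff_field_def carrier_c2_algebra F_def)
  have zero: "summand_zero n j = Inl ` {c2_elem 0 0 :: int \<Rightarrow> 'a alg_closure}"
    using j by (simp add: summand_zero_def c2_elem_def fun_eq_iff)
  have ideals: "summand_ideal n r \<alpha> j 1 0 = Inl ` {c2_elem k k | k. k \<in> F}"
      "summand_ideal n r \<alpha> j 0 1 = Inl ` {c2_elem k (- k) | k. k \<in> F}"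
    using j by (simp_all add: summand_ideal_def coeff_field_def F_def
        c2_ideals[OF subfield_of_range_to_ac])
  have orthogonal: "summand_orthogonal n r \<alpha> j (Inl (c2_elem p q)) (Inl (c2_elem p' q')) \<longleftrightarrow>
      p * p' + q * q' = 0 \<and> p * q' + q * p' = 0" for p q p' q'
    using j by (simp add: summand_orthogonal_def)
  have perpI: "summand_perp n r \<alpha> j B = Inl ` {c2_elem p q | p q. p \<in> F \<and> q \<in> F \<and> P p q}"
    if "\<And>p q. p \<in> F \<Longrightarrow> q \<in> F \<Longrightarrow>
      (\<forall>b\<in>B. summand_orthogonal n r \<alpha> j (Inl (c2_elem p q)) b) \<longleftrightarrow> P p q" for B P
    unfolding summand_perp_def algebra using that by blast
  show "summand_perp n r \<alpha> j (summand_zero n j) = summand_algebra n r \<alpha> j"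
    unfolding algebra by (subst perpI[where P = "\<lambda>p q. True"]) (auto simp: zero orthogonal)
  show "summand_perp n r \<alpha> j (summand_algebra n r \<alpha> j) = summand_zero n j"
  proof (subst perpI[where P = "\<lambda>p q. p = 0 \<and> q = 0"])
    fix p q assume "p \<in> F" "q \<in> F"
    show "(\<forall>b\<in>summand_algebra n r \<alpha> j. summand_orthogonal n r \<alpha> j (Inl (c2_elem p q)) b)
        \<longleftrightarrow> p = 0 \<and> q = 0"
    proof
      assume perp: "\<forall>b\<in>summand_algebra n r \<alpha> j. summand_orthogonal n r \<alpha> j (Inl (c2_elem p q)) b"
      have "Inl (c2_elem 1 0) \<in> summand_algebra n r \<alpha> j"
        unfolding algebra using F'(1,2) by blast
      then have "summand_orthogonal n r \<alpha> j (Inl (c2_elem p q)) (Inl (c2_elem 1 0))"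
        using perp by blast
      then show "p = 0 \<and> q = 0" by (simp add: orthogonal)
    qed (auto simp: algebra orthogonal)
  qed (use F'(2) in \<open>auto simp: zero\<close>)
  show "summand_perp n r \<alpha> j (summand_ideal n r \<alpha> j 1 0) = summand_ideal n r \<alpha> j 0 1"
  proof (subst perpI[where P = "\<lambda>p q. q = - p"])
    fix p q assume "p \<in> F" "q \<in> F"
    have "(\<forall>b\<in>summand_ideal n r \<alpha> j 1 0. summand_orthogonal n r \<alpha> j (Inl (c2_elem p q)) b)
        \<longleftrightarrow> (\<forall>k\<in>F. summand_orthogonal n r \<alpha> j (Inl (c2_elem p q)) (Inl (c2_elem k k)))"
      unfolding ideals by blast
    also have "\<dots> \<longleftrightarrow> (\<forall>k\<in>F. (p + q) * k = 0)"
      unfolding orthogonal by (simp only: distrib_right conj_absorb)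
    also have "\<dots> \<longleftrightarrow> p + q = 0"
      using F'(1) by (metis mult_1_right mult_zero_left)
    also have "\<dots> \<longleftrightarrow> q = - p"
      by (simp add: eq_neg_iff_add_eq_0 add.commute)
    finally show "(\<forall>b\<in>summand_ideal n r \<alpha> j 1 0. summand_orthogonal n r \<alpha> j (Inl (c2_elem p q)) b)
        \<longleftrightarrow> q = - p" .
  qed (simp add: ideals neg_in_F)
  show "summand_perp n r \<alpha> j (summand_ideal n r \<alpha> j 0 1) = summand_ideal n r \<alpha> j 1 0"
  proof (subst perpI[where P = "\<lambda>p q. q = p"])
    fix p q assume "p \<in> F" "q \<in> F"
    have "(\<forall>b\<in>summand_ideal n r \<alpha> j 0 1. summand_orthogonal n r \<alpha> j (Inl (c2_elem p q)) b)
        \<longleftrightarrow> (\<forall>k\<in>F. summand_orthogonal n r \<alpha> j (Inl (c2_elem p q)) (Inl (c2_elem k (- k))))"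
      unfolding ideals by blast
    also have "\<dots> \<longleftrightarrow> (\<forall>k\<in>F. p * k = q * k)"
      unfolding orthogonal by (intro ball_cong refl) auto
    also have "\<dots> \<longleftrightarrow> q = p"
      using F'(1) by (metis mult_1_right)
    finally show "(\<forall>b\<in>summand_ideal n r \<alpha> j 0 1. summand_orthogonal n r \<alpha> j (Inl (c2_elem p q)) b)
        \<longleftrightarrow> q = p" .
  qed (simp add: ideals)
qed

lemma summand_matrix:
  assumes "\<zeta> n < j"
  shows "summand_algebra n r \<alpha> j = Inr ` mat_over (coeff_field n r \<alpha> j)"
    and "summand_zero n j = Inr ` {0}"
    and "summand_ideal n r \<alpha> j x y = Inr ` row_ideal (coeff_field n r \<alpha> j) x y"
    and "summand_perp n r \<alpha> j (Inr ` N) =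
      Inr ` mat_perp (coeff_field n r \<alpha> j) (if j \<le> r then \<alpha> j + inverse (\<alpha> j) else 1)
              (if j \<le> r then 2 else 0) N"
proof -
  show algebra: "summand_algebra n r \<alpha> j = Inr ` mat_over (coeff_field n r \<alpha> j)"
    using assms by (simp add: summand_algebra_def mat_over_def)
  show "summand_zero n j = Inr ` {0}" using assms by (simp add: summand_zero_def)
  show "summand_ideal n r \<alpha> j x y = Inr ` row_ideal (coeff_field n r \<alpha> j) x y"
    using assms by (simp add: summand_ideal_def row_ideal_def)
  show "summand_perp n r \<alpha> j (Inr ` N) =
      Inr ` mat_perp (coeff_field n r \<alpha> j) (if j \<le> r then \<alpha> j + inverse (\<alpha> j) else 1)
              (if j \<le> r then 2 else 0) N"
    using assms unfolding summand_perp_def algebra by (auto simp: summand_orthogonal_def mat_perp_def)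
qed


section \<open>The decomposition attached to a factorization\<close>

text \<open>The factors \<open>f\<^sub>j\<close> for \<open>j > r\<close> come with a second factor that has the root \<open>\<alpha>\<^sub>j\<^sup>-\<^sup>1\<close>. The disjoint
  sum of index ranges below enumerates both kinds.\<close>

locale dihedral_decomposition =
  fixes n r s :: nat and f :: "nat \<Rightarrow> 'a::{field, finite} poly" and \<alpha> :: "nat \<Rightarrow> 'a alg_closure"
  assumes n: "n \<ge> 2" "coprime CARD('a) n"
    and factorization:
      "monom 1 n - 1 = (\<Prod>j=1..r. f j) * (\<Prod>j=r+1..r+s. f j * monic_reciprocal (f j))"
    and irreducible_f: "\<And>j. j \<in> {1..r+s} \<Longrightarrow> irreducible (f j)"
    and zeta_le: "\<zeta> n \<le> r" and f_1: "f 1 = [:-1, 1:]" and f_2: "even n \<Longrightarrow> f 2 = [:1, 1:]"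
    and self_reciprocal: "\<And>j. j \<in> {2..r} \<Longrightarrow> reflect_poly (f j) = f j"
    and root_f: "\<And>j. j \<in> {1..r+s} \<Longrightarrow> ev (f j) (\<alpha> j) = 0"
begin

abbreviation "factor_indices \<equiv> {1..r+s} <+> {r+1..r+s}"
abbreviation "factor_of \<equiv> case_sum f (\<lambda>j. monic_reciprocal (f j))"
abbreviation "factor_root \<equiv> case_sum \<alpha> (\<lambda>j. inverse (\<alpha> j))"

lemma factorization_Plus: "monom 1 n - 1 = (\<Prod>k\<in>factor_indices. factor_of k)"
proof -
  have "(\<Prod>j=1..r+s. f j) = (\<Prod>j=1..r. f j) * (\<Prod>j=r+1..r+s. f j)"
    by (rule prod.ub_add_nat) simp
  then show ?thesis
    unfolding factorization prod.Plus[OF finite_atLeastAtMost finite_atLeastAtMost]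
    by (simp add: prod.distrib mult.assoc)
qed

lemma factor_root_imp_root_of_unity:
  assumes "j \<in> {1..r+s}" "ev (f j) t = 0"
  shows "t ^ n = 1"
proof -
  have "ev (monom 1 n - 1) t = 0"
    unfolding factorization_Plus ev_prod using assms by (intro prod_zero) force+
  then show ?thesis by simp
qed

lemma alpha_power: "j \<in> {1..r+s} \<Longrightarrow> \<alpha> j ^ n = 1"
  using factor_root_imp_root_of_unity root_f by blast

lemma alpha_neq_0: "j \<in> {1..r+s} \<Longrightarrow> \<alpha> j \<noteq> 0"
  using alpha_power n(1) by (metis power_0_left zero_neq_one not_numeral_le_zero)

lemma coeff_0_f: "j \<in> {1..r+s} \<Longrightarrow> coeff (f j) 0 \<noteq> 0"
proof
  assume j: "j \<in> {1..r+s}" and "coeff (f j) 0 = 0"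
  then have "ev (f j) 0 = 0" by (cases "f j") (simp add: ev_pCons)
  from factor_root_imp_root_of_unity[OF j this] show False using n(1) by (simp add: power_0_left)
qed

sublocale split_root_of_unity_polynomial n factor_indices factor_of factor_root
proof
  show "n > 0" using n(1) by simp
  show "of_nat n \<noteq> (0 :: 'a)" using n(2) by (rule of_nat_neq_0_if_coprime_CARD)
  show "monom 1 n - 1 = (\<Prod>k\<in>factor_indices. factor_of k)" by (rule factorization_Plus)
  show "ev (factor_of k) (factor_root k) = 0" if "k \<in> factor_indices" for k
    using that root_f alpha_neq_0
    by (auto simp: monic_reciprocal_def ev_reflect_poly)
qed simp

lemma irreducible_factor:
  assumes "k \<in> factor_indices"
  shows "irreducible (factor_of k)"
proof (cases k)
  case (Inl j)
  then show ?thesis using assms irreducible_f by auto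
next
  case (Inr j)
  then have j: "j \<in> {1..r+s}" using assms by auto
  have "irreducible (reflect_poly (f j))"
    using irreducible_f[OF j] coeff_0_f[OF j] by (rule irreducible_reflect_poly)
  moreover have "monic_reciprocal (f j) = [:inverse (coeff (f j) 0):] * reflect_poly (f j)"
    by (simp add: monic_reciprocal_def)
  moreover have "is_unit [:inverse (coeff (f j) 0):]"
    using coeff_0_f[OF j] by (simp add: is_unit_const_poly_iff dvd_field_iff)
  ultimately show ?thesis using Inr by (simp add: irreducible_mult_unit_left del: mult_pCons_left)
qed

lemma alpha_1: "\<alpha> 1 = 1"
proof -
  have "1 \<in> {1..r+s}" using zeta_le by (auto simp: \<zeta>_def split: if_splits)
  from root_f[OF this] show ?thesis by (simp only: f_1) (simp add: ev_pCons)
qed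

lemma alpha_2: "even n \<Longrightarrow> \<alpha> 2 = - 1"
proof -
  assume even: "even n"
  then have "2 \<in> {1..r+s}" using zeta_le by (auto simp: \<zeta>_def)
  from root_f[OF this] show ?thesis
    by (simp only: f_2[OF even]) (simp add: ev_pCons eq_neg_iff_add_eq_0 add.commute)
qed

lemma alpha_linear:
  assumes "j \<in> {1..r+s}" "j \<le> \<zeta> n"
  shows "\<alpha> j = (if j = 1 then 1 else - 1)"
proof (cases "j = 1")
  case False
  then have "j = 2" "even n" using assms by (auto simp: \<zeta>_def split: if_splits)
  then show ?thesis using alpha_2 by simp
qed (use alpha_1 in simp)

text \<open>For \<open>j \<le> r\<close> the element \<open>\<alpha>\<^sub>j\<^sup>-\<^sup>1\<close> is a root of \<open>f\<^sub>j\<close> as well, so that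
  \<open>\<alpha>\<^sub>j \<mapsto> \<alpha>\<^sub>j\<^sup>-\<^sup>1\<close> induces an automorphism of \<open>adjoin (\<alpha> j)\<close>.\<close>

lemma conjugate_eq:
  assumes j: "j \<in> {1..r}" and eq: "ev p (\<alpha> j) = ev q (\<alpha> j)"
  shows "ev p (inverse (\<alpha> j)) = ev q (inverse (\<alpha> j))"
proof -
  have j': "j \<in> {1..r+s}" using j by auto
  have "ev (f j) (inverse (\<alpha> j)) = 0"
  proof (cases "j = 1")
    case True
    then show ?thesis using root_f[OF j'] alpha_1 by simp
  next
    case False
    then have "reflect_poly (f j) = f j" using j self_reciprocal by auto
    then have "ev (f j) (inverse (\<alpha> j)) = ev (reflect_poly (f j)) (inverse (\<alpha> j))" by simp
    then show ?thesis using alpha_neq_0[OF j'] root_f[OF j'] by (simp add: ev_reflect_poly)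
  qed
  have "f j dvd p - q"
    using irreducible_f[OF j'] root_f[OF j'] by (rule irreducible_dvd_if_common_root) (simp add: eq)
  then obtain k where "p - q = f j * k" by (elim dvdE)
  then have "ev (p - q) (inverse (\<alpha> j)) = ev (f j * k) (inverse (\<alpha> j))" by simp
  then show ?thesis using \<open>ev (f j) (inverse (\<alpha> j)) = 0\<close> by simp
qed

text \<open>Only \<open>1\<close> and \<open>-1\<close> equal their inverses. If they are \<open>n\<close>-th roots of unity, they are roots of the
  factors with index at most \<open>\<zeta> n\<close>, and factors with different indices have no common root.\<close>

lemma reciprocal_pair_alpha:
  assumes j: "\<zeta> n < j" "j \<le> r"
  shows "reciprocal_pair (\<alpha> j) (inverse (\<alpha> j))"
proof
  have j': "j \<in> {1..r+s}" "j \<noteq> 1" using j by (auto simp: \<zeta>_def split: if_splits)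
  show "\<alpha> j \<noteq> 0" using j'(1) by (rule alpha_neq_0)
  have distinct: "\<alpha> j \<noteq> \<alpha> l" if "l \<in> {1..r+s}" "l \<noteq> j" for l
    using no_common_roots[OF InlI[OF j'(1)] InlI[OF that(1)]] that root_f[OF that(1)] by auto
  show "\<alpha> j \<noteq> inverse (\<alpha> j)"
  proof
    assume "\<alpha> j = inverse (\<alpha> j)"
    then have "\<alpha> j * \<alpha> j = 1" using alpha_neq_0[OF j'(1)] by (metis right_inverse)
    then have "\<alpha> j = 1 \<or> \<alpha> j = - 1" by (simp add: square_eq_1_iff)
    moreover have "\<alpha> j \<noteq> 1" using distinct[of 1] j' alpha_1 by auto
    ultimately have minus: "\<alpha> j = - 1" by simp
    show False
    proof (cases "even n")
      case True
      then show False using minus distinct[of 2] alpha_2 j by (auto simp: \<zeta>_def)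
    next
      case False
      then have "\<alpha> j ^ n = - 1" using minus by simp
      then show False using alpha_power[OF j'(1)] minus \<open>\<alpha> j \<noteq> 1\<close> by simp
    qed
  qed
qed simp

lemma subfield_of_adjoin_alpha: "j \<in> {1..r+s} \<Longrightarrow> subfield_of (adjoin (\<alpha> j))"
  by (intro subfield_of_adjoin finite_adjoin_root_of_unity[OF alpha_power n_pos])

lemma alpha_plus_inverse_in_adjoin:
  "j \<in> {1..r+s} \<Longrightarrow> \<alpha> j + inverse (\<alpha> j) \<in> adjoin (\<alpha> j)"
  using subfield_ofD(5,7)[OF subfield_of_adjoin_alpha] generator_in_adjoin by blast

lemma subfield_of_coeff_field:
  assumes j: "j \<in> {1..r+s}"
  shows "subfield_of (coeff_field n r \<alpha> j)"
proof -
  have "finite (adjoin (\<alpha> j + inverse (\<alpha> j)))"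
    using adjoin_subset[OF alpha_plus_inverse_in_adjoin[OF j]]
      finite_adjoin_root_of_unity[OF alpha_power[OF j] n_pos] by (rule finite_subset)
  then show ?thesis
    using subfield_of_range_to_ac subfield_of_adjoin_alpha[OF j] subfield_of_adjoin
    by (auto simp: coeff_field_def)
qed

lemma eq_0_if_all_tau_eq_0:
  assumes u: "u \<in> carrier (dihedral_algebra n)"
    and zero: "\<And>j. j \<in> {1..r+s} \<Longrightarrow> \<tau> n (\<alpha> j) u = 0"
  shows "u = (\<lambda>g. 0)"
proof -
  have vanish: "ev (rot_poly n u) (factor_root k) = 0 \<and> ev (refl_poly n u) (factor_root k) = 0"
    if k: "k \<in> factor_indices" for k
  proof (cases k)
    case (Inl j)
    then have "j \<in> {1..r+s}" using k by auto
    from zero[OF this] show ?thesis by (simp add: Inl \<tau>_def zero_eq_mat22)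
  next
    case (Inr j)
    then have "j \<in> {1..r+s}" using k by auto
    from zero[OF this] show ?thesis by (simp add: Inr \<tau>_def zero_eq_mat22)
  qed
  have degree: "degree (rot_poly n u) < n" "degree (refl_poly n u) < n"
    using n_pos by (auto intro!: degree_lessI simp: coeff_rot_poly coeff_refl_poly)
  have "rot_poly n u = 0" "refl_poly n u = 0"
    using vanish degree by (blast intro: eq_0_if_vanishes_at_roots irreducible_factor)+
  then have "u (e, i) = 0" if "i < n" for e i
    using that coeff_rot_poly[of n u i] coeff_refl_poly[of n u i] by (cases e) auto
  moreover have "u (e, i) = 0" if "\<not> i < n" for e i
    using u that by (auto simp: group_algebra_def dihedral_group_def)
  ultimately show ?thesis by (metis ext prod.exhaust)
qed

text \<open>The possible values of \<open>\<tau>\<close> at \<open>\<alpha>\<^sub>j\<close>: for \<open>j > r\<close> the values of a polynomial at \<open>\<alpha>\<^sub>j\<close> and \<open>\<alpha>\<^sub>j\<^sup>-\<^sup>1\<close>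
  are independent, for \<open>j \<le> r\<close> the first determines the second.\<close>

definition tau_values :: "nat \<Rightarrow> ('a alg_closure^2^2) set" where
  "tau_values j =
     {mat22 (ev p (\<alpha> j)) (ev q' (inverse (\<alpha> j))) (ev q (\<alpha> j)) (ev p' (inverse (\<alpha> j))) | p q p' q'.
        j \<le> r \<longrightarrow> p' = p \<and> q' = q}"

lemma tau_interpolation:
  assumes M: "\<And>j. j \<in> {1..r+s} \<Longrightarrow> M j \<in> tau_values j"
  obtains u where "u \<in> carrier (dihedral_algebra n)" "\<And>j. j \<in> {1..r+s} \<Longrightarrow> \<tau> n (\<alpha> j) u = M j"
proof -
  obtain p q p' q' where eq: "\<And>j. j \<in> {1..r+s} \<Longrightarrow>
      M j = mat22 (ev (p j) (\<alpha> j)) (ev (q' j) (inverse (\<alpha> j))) (ev (q j) (\<alpha> j))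
              (ev (p' j) (inverse (\<alpha> j)))
        \<and> (j \<le> r \<longrightarrow> p' j = p j \<and> q' j = q j)"
    using M unfolding tau_values_def mem_Collect_eq by metis
  obtain P where P: "degree P < n"
    "\<And>k. k \<in> factor_indices \<Longrightarrow> ev P (factor_root k) = ev (case_sum p p' k) (factor_root k)"
    using interpolation[where p = "case_sum p p'"] by blast
  obtain Q where Q: "degree Q < n"
    "\<And>k. k \<in> factor_indices \<Longrightarrow> ev Q (factor_root k) = ev (case_sum q q' k) (factor_root k)"
    using interpolation[where p = "case_sum q q'"] by blast
  define u where "u g = coeff (if fst g then Q else P) (snd g)" for g :: "bool \<times> nat"
  have rot: "rot_poly n u = P" and refl: "refl_poly n u = Q"
    using P(1) Q(1) by (auto simp: poly_eq_iff coeff_rot_poly coeff_refl_poly u_def coeff_eq_0)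
  show ?thesis
  proof (rule that)
    show "u \<in> carrier (dihedral_algebra n)"
      using P(1) Q(1) by (auto simp: group_algebra_def dihedral_group_def u_def coeff_eq_0)
    fix j assume j: "j \<in> {1..r+s}"
    have at_alpha: "ev P (\<alpha> j) = ev (p j) (\<alpha> j)" "ev Q (\<alpha> j) = ev (q j) (\<alpha> j)"
      using P(2)[OF InlI[OF j]] Q(2)[OF InlI[OF j]] by simp_all
    have "ev P (inverse (\<alpha> j)) = ev (p' j) (inverse (\<alpha> j))
        \<and> ev Q (inverse (\<alpha> j)) = ev (q' j) (inverse (\<alpha> j))"
    proof (cases "j \<le> r")
      case True
      then have same: "p' j = p j" "q' j = q j" and jr: "j \<in> {1..r}" using eq[OF j] j by simp_all
      show ?thesis unfolding same using at_alpha[THEN conjugate_eq[OF jr]] by blast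
    next
      case False
      then have "j \<in> {r+1..r+s}" using j by simp
      from P(2)[OF InrI[OF this]] Q(2)[OF InrI[OF this]] show ?thesis by simp
    qed
    then show "\<tau> n (\<alpha> j) u = M j"
      using at_alpha eq[OF j] by (simp add: \<tau>_def rot refl)
  qed
qed

lemma ev_alpha_linear_in_range:
  assumes "j \<in> {1..r+s}" "j \<le> \<zeta> n"
  shows "ev p (\<alpha> j) \<in> range to_ac"
proof -
  have "ev p (to_ac c) = to_ac (poly p c)" for c
    by (induction p) (simp_all add: ev_pCons)
  moreover have "\<alpha> j = to_ac (if j = 1 then 1 else - 1)"
    using alpha_linear[OF assms] by simp
  ultimately show ?thesis by (metis rangeI)
qed

lemma proj_in_summand_algebra:
  assumes j: "j \<in> {1..r+s}"
  shows "proj n r \<alpha> j u \<in> summand_algebra n r \<alpha> j"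
proof -
  consider "j \<le> \<zeta> n" | "\<zeta> n < j" "j \<le> r" | "\<zeta> n < j" "r < j" by linarith
  then show ?thesis
  proof cases
    case 1
    then show ?thesis
      using ev_alpha_linear_in_range[OF j 1] alpha_linear[OF j 1]
      by (auto simp: proj_def \<gamma>_def Let_def summand_algebra_def coeff_field_def carrier_c2_algebra)
  next
    case 2
    interpret reciprocal_pair "\<alpha> j" "inverse (\<alpha> j)" using 2 by (rule reciprocal_pair_alpha)
    have "\<sigma> (\<alpha> j) (\<tau> n (\<alpha> j) u) \<in> mat_over (coeff_field n r \<alpha> j)"
      using sigma_tau_in_mat_over subfield_of_coeff_field[OF j] 2 by (simp add: coeff_field_def)
    then show ?thesis using 2 by (simp add: proj_def summand_matrix)
  next
    case 3
    have "inverse (\<alpha> j) \<in> adjoin (\<alpha> j)"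
      using subfield_ofD(5)[OF subfield_of_adjoin_alpha[OF j]] generator_in_adjoin by blast
    then have "adjoin (inverse (\<alpha> j)) \<subseteq> adjoin (\<alpha> j)" by (rule adjoin_subset)
    then have "\<tau> n (\<alpha> j) u \<in> mat_over (coeff_field n r \<alpha> j)"
      using 3 by (auto simp: coeff_field_def \<tau>_def)
    then show ?thesis using 3 by (simp add: proj_def summand_matrix)
  qed
qed

text \<open>Local surjectivity. The three cases are constant polynomials, undoing the conjugation \<open>\<sigma>\<close>, and
  reading off four independent values.\<close>

lemma summand_element_from_tau:
  assumes j: "j \<in> {1..r+s}" and y: "y \<in> summand_algebra n r \<alpha> j"
  shows "\<exists>M\<in>tau_values j. \<forall>u. \<tau> n (\<alpha> j) u = M \<longrightarrow> proj n r \<alpha> j u = y"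
proof -
  have inverse_ev: "ev (monom 1 (n - 1)) (\<alpha> j) = inverse (\<alpha> j)"
      "ev (monom 1 (n - 1)) (inverse (\<alpha> j)) = \<alpha> j"
    using power_root_of_unity_diff[of "\<alpha> j" n 1] power_root_of_unity_diff[of "inverse (\<alpha> j)" n 1]
      alpha_power[OF j] n_pos by (simp_all add: power_inverse)
  consider "j \<le> \<zeta> n" | "\<zeta> n < j" "j \<le> r" | "\<zeta> n < j" "r < j" by linarith
  then show ?thesis
  proof cases
    case 1
    then obtain a b where y_eq: "y = Inl (c2_elem (to_ac a) (to_ac b))"
      using y by (auto simp: summand_algebra_def coeff_field_def carrier_c2_algebra)
    have "proj n r \<alpha> j u = y" if "\<tau> n (\<alpha> j) u = mat22 (to_ac a) (to_ac b) (to_ac b) (to_ac a)" for u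
      using that 1 alpha_linear[OF j 1] by (auto simp: proj_def \<gamma>_def \<tau>_def Let_def y_eq)
    moreover have "mat22 (to_ac a) (to_ac b) (to_ac b) (to_ac a) \<in> tau_values j"
      unfolding tau_values_def mem_Collect_eq
      by (intro exI[of _ "[:a:]"] exI[of _ "[:b:]"]) simp
    ultimately show ?thesis by blast
  next
    case 2
    interpret reciprocal_pair "\<alpha> j" "inverse (\<alpha> j)" using 2 by (rule reciprocal_pair_alpha)
    obtain A where A: "y = Inr A" "A \<in> mat_over (adjoin (\<alpha> j + inverse (\<alpha> j)))"
      using y 2 by (auto simp: summand_matrix coeff_field_def)
    have jr: "j \<in> {1..r}" using j 2 by simp
    obtain p q where "Z ** A ** W =
        mat22 (ev p (\<alpha> j)) (ev q (inverse (\<alpha> j))) (ev q (\<alpha> j)) (ev p (inverse (\<alpha> j)))"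
      using rational_matrix_is_sigma_image[OF A(2) subfield_of_adjoin_alpha[OF j]
          conjugate_eq[OF jr] inverse_ev] by blast
    then have "Z ** A ** W \<in> tau_values j" unfolding tau_values_def by blast
    moreover have "\<forall>u. \<tau> n (\<alpha> j) u = Z ** A ** W \<longrightarrow> proj n r \<alpha> j u = y"
      using 2 by (simp add: proj_def sigma_conjugate A(1))
    ultimately show ?thesis by blast
  next
    case 3
    obtain A where A: "y = Inr A" "A \<in> mat_over (adjoin (\<alpha> j))"
      using y 3 by (auto simp: summand_matrix coeff_field_def)
    obtain a b c d where A_eq: "A = mat22 a b c d" by (rule mat22_cases)
    have "\<alpha> j \<in> adjoin (inverse (\<alpha> j))"
      using adjoinI[of "monom 1 (n - 1)" "inverse (\<alpha> j)"] by (simp only: inverse_ev)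
    then have "adjoin (\<alpha> j) \<subseteq> adjoin (inverse (\<alpha> j))" by (rule adjoin_subset)
    then have "a \<in> adjoin (\<alpha> j)" "b \<in> adjoin (inverse (\<alpha> j))" "c \<in> adjoin (\<alpha> j)"
      "d \<in> adjoin (inverse (\<alpha> j))"
      using A(2) by (auto simp: A_eq)
    then obtain p q' q p' where "a = ev p (\<alpha> j)" "b = ev q' (inverse (\<alpha> j))" "c = ev q (\<alpha> j)"
      "d = ev p' (inverse (\<alpha> j))"
      by (auto simp: adjoin_def)
    then have "A = mat22 (ev p (\<alpha> j)) (ev q' (inverse (\<alpha> j))) (ev q (\<alpha> j)) (ev p' (inverse (\<alpha> j)))"
      by (simp add: A_eq)
    moreover have "\<not> j \<le> r" using 3 by simp
    ultimately have "A \<in> tau_values j" unfolding tau_values_def by blast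
    moreover have "\<forall>u. \<tau> n (\<alpha> j) u = A \<longrightarrow> proj n r \<alpha> j u = y"
      using 3 by (simp add: proj_def A(1))
    ultimately show ?thesis by blast
  qed
qed

lemma decomp_surj:
  assumes y: "y \<in> (\<Pi>\<^sub>E j\<in>{1..r+s}. summand_algebra n r \<alpha> j)"
  obtains u where "u \<in> carrier (dihedral_algebra n)" "decomp n r s \<alpha> u = y"
proof -
  have "\<forall>j\<in>{1..r+s}. \<exists>M. M \<in> tau_values j \<and> (\<forall>u. \<tau> n (\<alpha> j) u = M \<longrightarrow> proj n r \<alpha> j u = y j)"
    using summand_element_from_tau PiE_mem[OF y] by blast
  from bchoice[OF this] obtain M where M: "\<And>j. j \<in> {1..r+s} \<Longrightarrow> M j \<in> tau_values j"
    and proj: "\<And>j u. j \<in> {1..r+s} \<Longrightarrow> \<tau> n (\<alpha> j) u = M j \<Longrightarrow> proj n r \<alpha> j u = y j"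
    by blast
  obtain u where u: "u \<in> carrier (dihedral_algebra n)"
    "\<And>j. j \<in> {1..r+s} \<Longrightarrow> \<tau> n (\<alpha> j) u = M j"
    using tau_interpolation[OF M] by blast
  have "decomp n r s \<alpha> u = y"
  proof
    fix j
    show "decomp n r s \<alpha> u j = y j"
    proof (cases "j \<in> {1..r+s}")
      case True
      then show ?thesis using proj[OF True u(2)[OF True]] by (simp add: decomp_def)
    next
      case False
      then show ?thesis using PiE_arb[OF y False] by (simp only: decomp_def restrict_apply if_False)
    qed
  qed
  with u(1) show ?thesis by (rule that)
qed

lemma summand_orthogonal_proj_iff:
  assumes j: "j \<in> {1..r+s}"
  shows "summand_orthogonal n r \<alpha> j (proj n r \<alpha> j u) (proj n r \<alpha> j c) \<longleftrightarrow>
    \<tau> n (\<alpha> j) u ** antitranspose (\<tau> n (\<alpha> j) c) = 0"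
proof -
  consider "j \<le> \<zeta> n" | "\<zeta> n < j" "j \<le> r" | "\<zeta> n < j" "r < j" by linarith
  then show ?thesis
  proof cases
    case 1
    then show ?thesis
      using alpha_linear[OF j 1]
      by (auto simp: summand_orthogonal_def proj_def \<gamma>_def \<tau>_def Let_def mat22_mult zero_eq_mat22
          algebra_simps)
  next
    case 2
    interpret reciprocal_pair "\<alpha> j" "inverse (\<alpha> j)" using 2 by (rule reciprocal_pair_alpha)
    show ?thesis using 2 product_eq_0_iff_sigma by (simp add: summand_orthogonal_def proj_def)
  next
    case 3
    then show ?thesis by (simp add: summand_orthogonal_def proj_def flip: mat_eq_mat22)
  qed
qed

text \<open>An element of the group algebra is zero if all its images under \<open>\<tau>\<close> are, so the vanishing of the
  correlations decomposes into one orthogonality relation for each component.\<close>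

lemma mem_dual_code_iff_proj:
  assumes code: "dihedral_code n I"
  shows "u \<in> dual_code n I \<longleftrightarrow> u \<in> carrier (dihedral_algebra n) \<and>
    (\<forall>j\<in>{1..r+s}. proj n r \<alpha> j u \<in> summand_perp n r \<alpha> j (proj n r \<alpha> j ` I))"
proof -
  have "correlation n u c = (\<lambda>g. 0) \<longleftrightarrow>
      (\<forall>j\<in>{1..r+s}. \<tau> n (\<alpha> j) u ** antitranspose (\<tau> n (\<alpha> j) c) = 0)" for c
  proof -
    have "correlation n u c = (\<lambda>g. 0) \<longleftrightarrow> (\<forall>j\<in>{1..r+s}. \<tau> n (\<alpha> j) (correlation n u c) = 0)"
    proof
      assume "correlation n u c = (\<lambda>g. 0)"
      then show "\<forall>j\<in>{1..r+s}. \<tau> n (\<alpha> j) (correlation n u c) = 0"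
        by (simp add: tau_eq_sum)
    next
      assume "\<forall>j\<in>{1..r+s}. \<tau> n (\<alpha> j) (correlation n u c) = 0"
      moreover have "correlation n u c \<in> carrier (dihedral_algebra n)"
        by (simp add: correlation_def group_algebra_def)
      ultimately show "correlation n u c = (\<lambda>g. 0)" by (intro eq_0_if_all_tau_eq_0) auto
    qed
    also have "\<dots> \<longleftrightarrow> (\<forall>j\<in>{1..r+s}. \<tau> n (\<alpha> j) u ** antitranspose (\<tau> n (\<alpha> j) c) = 0)"
      by (intro ball_cong refl) (simp only: tau_correlation[OF alpha_power n_pos])
    finally show ?thesis .
  qed
  then show ?thesis
    unfolding mem_dual_code_iff_correlation[OF n_pos code] summand_perp_def
    using proj_in_summand_algebra by (auto simp: summand_orthogonal_proj_iff)
qed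

text \<open>For \<open>j > \<zeta> n\<close> the ideals in the definition of \<open>dual_summand\<close> are the values of \<open>mat_perp_row_ideal\<close> at
  \<open>(1, 0)\<close>, \<open>(0, 1)\<close> and \<open>(-x, 1)\<close>, the first up to the factor \<open>-1\<close>. Each branch of the
  case distinction is correct for every \<open>B\<close> that satisfies its test, so it is enough that some test
  succeeds.\<close>

lemma dual_summand_eq_perp:
  assumes j: "j \<in> {1..r+s}"
    and B: "B = summand_zero n j \<or> B = summand_algebra n r \<alpha> j
      \<or> B = summand_ideal n r \<alpha> j 1 0 \<or> B = summand_ideal n r \<alpha> j 0 1
      \<or> \<zeta> n < j \<and> x \<in> coeff_field n r \<alpha> j \<and> B = summand_ideal n r \<alpha> j (- x) 1"
  shows "dual_summand n r \<alpha> j x B = summand_perp n r \<alpha> j B"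
proof (cases "j \<le> \<zeta> n")
  case True
  then show ?thesis
    using B summand_perp_c2[OF True, of r \<alpha>] unfolding dual_summand_def Let_def by auto
next
  case False
  then have j_gt: "\<zeta> n < j" by simp
  let ?F = "coeff_field n r \<alpha> j"
  \<comment> \<open>The parameters of \<open>mat_perp\<close> that cover the self-reciprocal and the other matrix components
    at once.\<close>
  define c where "c = (if j \<le> r then \<alpha> j + inverse (\<alpha> j) else 1)"
  define d :: "'a alg_closure" where "d = (if j \<le> r then 2 else 0)"
  have F: "subfield_of ?F" using j by (rule subfield_of_coeff_field)
  note F' = subfield_ofD[OF F]
  have c: "c \<in> ?F"
    using j_gt generator_in_adjoin[of "\<alpha> j + inverse (\<alpha> j)"] F'(1)
    by (auto simp: c_def coeff_field_def)
  have d: "d \<in> ?F" using F'(2) F'(10) by (simp add: d_def)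
  have cd: "c\<^sup>2 \<noteq> d\<^sup>2"
  proof (cases "j \<le> r")
    case True
    interpret reciprocal_pair "\<alpha> j" "inverse (\<alpha> j)" using j_gt True by (rule reciprocal_pair_alpha)
    have "c\<^sup>2 - d\<^sup>2 = (\<alpha> j - inverse (\<alpha> j))\<^sup>2"
      using True t_mult_t' by (simp add: c_def d_def power2_eq_square algebra_simps)
    then show ?thesis using t_neq_t' by auto
  qed (simp add: c_def d_def)
  note matrix = summand_matrix(1,3)[OF j_gt, of r \<alpha>] summand_matrix(2)[OF j_gt]
    summand_matrix(4)[OF j_gt, of r \<alpha>, folded c_def d_def]
  have perp: "summand_perp n r \<alpha> j (summand_ideal n r \<alpha> j x y)
      = summand_ideal n r \<alpha> j (d * y - c * x) (c * y - d * x)"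
    if "x \<in> ?F" "y \<in> ?F" "x \<noteq> 0 \<or> y \<noteq> 0" for x y
    unfolding matrix using mat_perp_row_ideal[OF F c d that(1,2) cd that(3)] by simp
  have "c \<noteq> 0 \<or> d \<noteq> 0" using cd by auto
  then have "row_ideal ?F (- 1 * c) (- 1 * d) = row_ideal ?F c d"
    using F c d F'(1,6) by (intro row_ideal_scale) auto
  then have perp_10: "summand_perp n r \<alpha> j (summand_ideal n r \<alpha> j 1 0) = summand_ideal n r \<alpha> j c d"
    using perp[of 1 0] F'(1,2) by (simp add: matrix)
  have perp_01: "summand_perp n r \<alpha> j (summand_ideal n r \<alpha> j 0 1) = summand_ideal n r \<alpha> j d c"
    using perp[of 0 1] F'(1,2) by simp
  have perp_x: "summand_perp n r \<alpha> j (summand_ideal n r \<alpha> j (- x) 1)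
      = summand_ideal n r \<alpha> j (d + c * x) (c + d * x)" if "x \<in> ?F"
    using perp[of "- x" 1] that F'(1,6) by simp
  have perp_zero: "summand_perp n r \<alpha> j (summand_zero n j) = summand_algebra n r \<alpha> j"
    unfolding matrix by (simp add: mat_perp_zero)
  have perp_full: "summand_perp n r \<alpha> j (summand_algebra n r \<alpha> j) = summand_zero n j"
    unfolding matrix using mat_perp_full[OF F cd] by simp
  show ?thesis
  proof (cases "j \<le> r")
    case True
    then have "c = \<alpha> j + inverse (\<alpha> j)" "d = 2" by (simp_all add: c_def d_def)
    then show ?thesis
      using B False True perp_10 perp_01 perp_x perp_zero perp_full
      unfolding dual_summand_def Let_def by auto
  next
    case r_less: False
    then have "c = 1" "d = 0" by (simp_all add: c_def d_def)
    then show ?thesis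
      using B False r_less perp_10 perp_01 perp_x perp_zero perp_full
      unfolding dual_summand_def Let_def by auto
  qed
qed

end


section \<open>The dual of a dihedral code\<close>

theorem theorem5:
  fixes n r s :: nat
    and f :: "nat \<Rightarrow> 'a::{field, finite} poly"
    and \<alpha> x :: "nat \<Rightarrow> 'a alg_closure"
    and I :: "(bool \<times> nat \<Rightarrow> 'a) set"
    and J1 J2 J3 J4 :: "nat set"
    and B :: "nat \<Rightarrow> 'a alg_closure summand set"
  assumes n: "n \<ge> 2" "coprime CARD('a) n"
    and factorization:
      "monom 1 n - 1 = (\<Prod>j=1..r. f j) * (\<Prod>j=r+1..r+s. f j * monic_reciprocal (f j))"
      "\<forall>j\<in>{1..r+s}. lead_coeff (f j) = 1 \<and> irreducible (f j)"
      "distinct (map f [1..<r+s+1] @ map (\<lambda>j. monic_reciprocal (f j)) [r+1..<r+s+1])"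
      "\<zeta> n \<le> r" "f 1 = [:-1, 1:]" "even n \<longrightarrow> f 2 = [:1, 1:]"
      "\<forall>j\<in>{2..r}. reflect_poly (f j) = f j"
      "\<forall>j\<in>{r+1..r+s}. \<forall>t. \<not> (ev (f j) t = 0 \<and> ev (reflect_poly (f j)) t = 0)"
    and roots: "\<forall>j\<in>{1..r+s}. ev (f j) (\<alpha> j) = 0"
    and code: "dihedral_code n I"
    and index_sets:
      "J1 \<subseteq> {1..r+s}" "J2 \<subseteq> {1..r+s}" "J3 \<subseteq> {1..r+s}" "J4 \<subseteq> {\<zeta> n + 1..r+s}"
      "J1 \<inter> J2 = {}" "J1 \<inter> J3 = {}" "J1 \<inter> J4 = {}"
      "J2 \<inter> J3 = {}" "J2 \<inter> J4 = {}" "J3 \<inter> J4 = {}"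
      "even CARD('a) \<longrightarrow> 1 \<notin> J2"
    and params: "\<forall>j\<in>J4. x j \<in> coeff_field n r \<alpha> j \<and> x j \<noteq> 0"
    and B: "\<forall>j\<in>{1..r+s}. B j =
       (if j \<in> J1 then summand_algebra n r \<alpha> j
        else if j \<in> J2 then summand_ideal n r \<alpha> j 0 1
        else if j \<in> J3 then summand_ideal n r \<alpha> j 1 0
        else if j \<in> J4 then summand_ideal n r \<alpha> j (- x j) 1
        else summand_zero n j)"
    and image: "decomp n r s \<alpha> ` I = (\<Pi>\<^sub>E j\<in>{1..r+s}. B j)"
  shows "decomp n r s \<alpha> ` dual_code n I =
           (\<Pi>\<^sub>E j\<in>{1..r+s}. dual_summand n r \<alpha> j (x j) (B j))"
proof -
  interpret dihedral_decomposition n r s f \<alpha>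
    using n factorization roots by unfold_locales auto
  have "additive_subgroup I (dihedral_algebra n)"
    using code by (simp add: dihedral_code_def left_ideal_def)
  then have "(\<Pi>\<^sub>E j\<in>{1..r+s}. B j) \<noteq> {}"
    using additive_subgroup.zero_closed image by blast
  then have proj_I: "proj n r \<alpha> j ` I = B j" if "j \<in> {1..r+s}" for j
  proof -
    have "proj n r \<alpha> j ` I = (\<lambda>y. y j) ` (decomp n r s \<alpha> ` I)"
      using that by (simp add: image_image decomp_def)
    then show ?thesis
      using \<open>_ \<noteq> {}\<close> that unfolding image image_projection_PiE by simp
  qed
  have dual: "dual_summand n r \<alpha> j (x j) (B j) = summand_perp n r \<alpha> j (B j)"
    if j: "j \<in> {1..r+s}" for j
  proof (rule dual_summand_eq_perp[OF j])
    show "B j = summand_zero n j \<or> B j = summand_algebra n r \<alpha> j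
      \<or> B j = summand_ideal n r \<alpha> j 1 0 \<or> B j = summand_ideal n r \<alpha> j 0 1
      \<or> \<zeta> n < j \<and> x j \<in> coeff_field n r \<alpha> j \<and> B j = summand_ideal n r \<alpha> j (- x j) 1"
      using bspec[OF B j] params index_sets(4) by (auto split: if_splits)
  qed
  have mem: "u \<in> dual_code n I \<longleftrightarrow> u \<in> carrier (dihedral_algebra n) \<and>
      decomp n r s \<alpha> u \<in> (\<Pi>\<^sub>E j\<in>{1..r+s}. summand_perp n r \<alpha> j (B j))" for u
    unfolding mem_dual_code_iff_proj[OF code] using proj_I by (auto simp: decomp_def PiE_iff)
  have "(\<Pi>\<^sub>E j\<in>{1..r+s}. dual_summand n r \<alpha> j (x j) (B j))
      = (\<Pi>\<^sub>E j\<in>{1..r+s}. summand_perp n r \<alpha> j (B j))"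
    using dual by (intro PiE_cong) auto
  also have "\<dots> = decomp n r s \<alpha> ` dual_code n I"
  proof
    show "(\<Pi>\<^sub>E j\<in>{1..r+s}. summand_perp n r \<alpha> j (B j)) \<subseteq> decomp n r s \<alpha> ` dual_code n I"
    proof
      fix y assume y: "y \<in> (\<Pi>\<^sub>E j\<in>{1..r+s}. summand_perp n r \<alpha> j (B j))"
      then have "y \<in> (\<Pi>\<^sub>E j\<in>{1..r+s}. summand_algebra n r \<alpha> j)"
        by (auto simp: summand_perp_def PiE_iff)
      then obtain u where "u \<in> carrier (dihedral_algebra n)" "decomp n r s \<alpha> u = y"
        by (rule decomp_surj)
      then show "y \<in> decomp n r s \<alpha> ` dual_code n I" using mem y by blast
    qed
  qed (use mem in auto)
  finally show ?thesis by simp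
qed

end
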